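(* Let $\mu,\nu$ be Radon measures on $\mathbb{R}$, both globally doubling, and assume that for some $C\geq 1$, $$\int_{B(x,2r)}\int_0^{2r}\alpha^2_{\mu,\nu}(B(y,t))\,\frac{dt\,d\mu(y)}{t} \leq C\mu(B(x,r)) \qquad\text{for all } x\in\mathbb{R},\ r>0,$$ where $B(x,r) = (x-r,x+r)$. Then $\mu\in A_\infty(\nu)$, i.e. there is $p<\infty$ such that the maximal operator $M_\nu f(x) = \sup_{I\ni x}\frac{1}{\nu(I)}\int_I|f|\,d\nu$ (supremum over intervals $I$ containing $x$) is bounded on $L^p(\mu)$.
   Context: A measure $\sigma$ on $\mathbb{R}$ is globally doubling if $\sigma(B(x,2r))\le C\sigma(B(x,r))$ for all $x\in\mathbb{R}$, $r>0$. Wasserstein distance: $\mathbb{W}_1(\nu_1,\nu_2) := \sup_\psi |\int\psi\,d\nu_1 - \int\psi\,d\nu_2|$ over all $1$-Lipschitz $\psi\colon\mathbb{R}\to\mathbb{R}$ supported on $[0,1]$. For an interval $I$, $T_I$ is the increasing affine map taking $\overline I$ onto $[0,1]$, $\mu_I := T_{I\sharp}(\mu|_I)/\mu(I)$, $\nu_I := T_{I\sharp}(\nu|_I)/\nu(I)$, and $\alpha_{\mu,\nu}(I) := \mathbb{W}_1(\mu_I,\nu_I)$. *)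

theory Defs
  imports "HOL-Analysis.Analysis"
begin

definition radon :: "real measure \<Rightarrow> bool" where
  "radon M \<longleftrightarrow> sets M = sets borel \<and> (\<forall>K. compact K \<longrightarrow> emeasure M K < \<infinity>)"

definition globally_doubling :: "real measure \<Rightarrow> bool" where
  "globally_doubling M \<longleftrightarrow> (\<exists>C::real. \<forall>x r. r > 0 \<longrightarrow>
      emeasure M (ball x (2 * r)) \<le> ennreal C * emeasure M (ball x r))"

definition T_int :: "real set \<Rightarrow> real \<Rightarrow> real" where
  "T_int I x = (x - Inf I) / (Sup I - Inf I)"

definition W1_tests :: "(real \<Rightarrow> real) set" where
  "W1_tests = {\<psi>. 1-lipschitz_on UNIV \<psi> \<and> (\<forall>s. s \<notin> {0..1} \<longrightarrow> \<psi> s = 0)}"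

text \<open>Integral of psi against the normalized push-forward measure mu_I = T_I#(mu|_I)/mu(I).\<close>
definition normint :: "real measure \<Rightarrow> real set \<Rightarrow> (real \<Rightarrow> real) \<Rightarrow> real" where
  "normint M I \<psi> = (LINT y:I|M. \<psi> (T_int I y)) / measure M I"

text \<open>alpha_{mu,nu}(I) = W1(mu_I, nu_I).\<close>
definition alpha :: "real measure \<Rightarrow> real measure \<Rightarrow> real set \<Rightarrow> real" where
  "alpha \<mu> \<nu> I = (SUP \<psi>\<in>W1_tests. \<bar>normint \<mu> I \<psi> - normint \<nu> I \<psi>\<bar>)"

definition maxop :: "real measure \<Rightarrow> (real \<Rightarrow> real) \<Rightarrow> real \<Rightarrow> ennreal" where
  "maxop \<nu> f x = (SUP I\<in>{I. is_interval I \<and> bounded I \<and> interior I \<noteq> {} \<and> x \<in> I}.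
       (\<integral>\<^sup>+ y\<in>I. ennreal \<bar>f y\<bar> \<partial>\<nu>) / emeasure \<nu> I)"

definition enn_powr :: "ennreal \<Rightarrow> real \<Rightarrow> ennreal" where
  "enn_powr a p = (if a = \<infinity> then \<infinity> else ennreal (enn2real a powr p))"

definition maxop_bounded_Lp :: "real measure \<Rightarrow> real measure \<Rightarrow> real \<Rightarrow> bool" where
  "maxop_bounded_Lp \<nu> \<mu> p \<longleftrightarrow> (\<exists>K::real. \<forall>f \<in> borel_measurable borel.
      (\<integral>\<^sup>+ x. ennreal (\<bar>f x\<bar> powr p) \<partial>\<mu>) < \<infinity> \<longrightarrow>
      (\<integral>\<^sup>+ x. enn_powr (maxop \<nu> f x) p \<partial>\<mu>) \<le> ennreal K * (\<integral>\<^sup>+ x. ennreal (\<bar>f x\<bar> powr p) \<partial>\<mu>))"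

definition A_infty :: "real measure \<Rightarrow> real measure \<Rightarrow> bool" where
  "A_infty \<mu> \<nu> \<longleftrightarrow> (\<exists>p::real. 1 \<le> p \<and> maxop_bounded_Lp \<nu> \<mu> p)"

end

theory Submission
  imports Defs
begin

text \<open>Let \<open>b\<close> be the tent of radius \<open>r\<close> at \<open>p\<close> and \<open>b'\<close> its left half. Since \<open>b'\<close> at scale \<open>r\<close> minus \<open>b'\<close>
  at scale \<open>r/2\<close> is Lipschitz, the difference of the ratios of \<open>b'\<close> to \<open>b\<close> under the two measures at scale
  \<open>r\<close> is an alpha-number plus a contraction of the same difference at scale \<open>r/2\<close>. Summing this over
  the dyadic points of an interval turns the hypothesis into a Carleson packing condition for the
  differences of the sharp dyadic splitting ratios of \<open>\<mu>\<close> and \<open>\<nu>\<close>.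

  By the chi-square bound, this packing condition bounds the relative entropy of \<open>\<mu>\<close> with respect to
  \<open>\<nu>\<close> on every dyadic partition of every interval, so that sets with small \<open>\<mu>\<close>-proportion miss a fixed
  \<open>\<nu>\<close>-proportion. A Calderon-Zygmund iteration upgrades this to a power estimate: if the
  \<open>\<mu>\<close>-proportion is at most \<open>\<delta>\<^sup>k\<close>, then the \<open>\<nu>\<close>-proportion is at most \<open>4\<^sup>-\<^sup>k\<close>. Hence a \<open>\<nu>\<close>-average exceeding
  \<open>l\<close> forces some level set \<open>|f| > 2\<^sup>k l/4\<close> to have \<open>\<mu>\<close>-density at least \<open>\<delta>\<^sup>k\<^sup>+\<^sup>1\<close>, and the Vitali covering
  lemma for \<open>\<mu>\<close> together with a layer-cake summation gives the \<open>L\<^sup>p\<close> bound once \<open>2\<^sup>p > 1/\<delta>\<close>.\<close>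

section \<open>Doubling measures on the line\<close>

text \<open>Two obstacles shape the argument. The numbers \<alpha> see only Lipschitz functions,
  whereas dyadic ratios involve sharp indicators. The indicator of a half-open interval is an exact
  combination of tents and half-tents, so the only non-Lipschitz information is the jump at a dyadic
  point. Its error at scale r is bounded through the finer scale r/2, so no coarse scale can start
  an induction. The factor before the finer error is below 1 because doubling leaves a fixed share
  of the tent mass outside half the radius; after squaring and weighting with that mass, each
  generation absorbs the next finer one, and the finest has a trivial bound by the total mass.
  Squares also suit the second half: one refinement raises the entropy by at most a multiple of the
  squared difference of the ratios. The entropy is that of \<mu> relative to \<nu> because the
  packing carries \<mu>-weights. If it is bounded, a set carrying most of \<mu> cannot have tiny
  \<nu>-mass, which is the direction needed for \<nu>-averages acting on L^p(\<mu>).\<close>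

locale doubling =
  fixes M :: "real measure" and D :: real
  assumes sets_borel [simp, measurable_cong]: "sets M = sets borel"
    and compact_fin: "compact K \<Longrightarrow> emeasure M K < \<infinity>"
    and nonzero: "emeasure M UNIV \<noteq> 0"
    and D_ge_1: "D \<ge> 1"
    and emeasure_double: "r > 0 \<Longrightarrow> emeasure M (ball x (2 * r)) \<le> ennreal D * emeasure M (ball x r)"
begin

lemma space_UNIV [simp]: "space M = UNIV"
  using sets_eq_imp_space_eq[OF sets_borel] by simp

lemma measurable_M [simp]: "measurable M = measurable borel"
  by (intro ext measurable_cong_sets) simp_all

lemma emeasure_bounded:
  assumes "bounded S" shows "emeasure M S < \<infinity>"
proof -
  obtain r where "S \<subseteq> cball 0 r"
    using assms bounded_subset_ballD[of S 0] ball_subset_cball by (metis order_trans)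
  then have "emeasure M S \<le> emeasure M (cball 0 r)"
    by (intro emeasure_mono) auto
  with compact_fin[OF compact_cball] show ?thesis
    using order_le_less_trans by blast
qed

lemma emeasure_eq: "bounded S \<Longrightarrow> emeasure M S = ennreal (measure M S)"
  using emeasure_bounded[of S] by (simp add: emeasure_eq_ennreal_measure)

lemma fmeas: "bounded S \<Longrightarrow> S \<in> sets borel \<Longrightarrow> S \<in> fmeasurable M"
  using emeasure_bounded by (simp add: fmeasurable_def)

lemma measure_mono_bounded:
  "S \<subseteq> T \<Longrightarrow> bounded T \<Longrightarrow> S \<in> sets borel \<Longrightarrow> T \<in> sets borel \<Longrightarrow> measure M S \<le> measure M T"
  by (intro measure_mono_fmeasurable fmeas) auto

lemma measure_ball_double:
  assumes "r > 0" shows "measure M (ball x (2 * r)) \<le> D * measure M (ball x r)"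
proof -
  have "ennreal (measure M (ball x (2 * r))) \<le> ennreal (D * measure M (ball x r))"
    using emeasure_double[OF assms, of x] D_ge_1 by (simp add: emeasure_eq ennreal_mult)
  then show ?thesis
    using D_ge_1 by (simp add: ennreal_le_iff)
qed

lemma measure_ball_double_pow:
  assumes "r > 0" shows "measure M (ball x (2 ^ k * r)) \<le> D ^ k * measure M (ball x r)"
proof (induction k)
  case (Suc k)
  have "measure M (ball x (2 * (2 ^ k * r))) \<le> D * measure M (ball x (2 ^ k * r))"
    by (rule measure_ball_double) (use assms in auto)
  also have "\<dots> \<le> D * (D ^ k * measure M (ball x r))"
    by (rule mult_left_mono[OF Suc]) (use D_ge_1 in auto)
  finally show ?case by (simp add: mult.assoc)
qed simp

lemma measure_le_ball:
  assumes "r > 0" "S \<subseteq> ball x (2 ^ k * r)" "S \<in> sets borel"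
  shows "measure M S \<le> D ^ k * measure M (ball x r)"
  using measure_mono_bounded[OF assms(2)] measure_ball_double_pow[OF assms(1), of x k] assms(3)
  by fastforce

text \<open>A null ball makes all its 2^k-fold dilates null, and these exhaust the line, against
  \<open>nonzero\<close>.\<close>

lemma ball_pos:
  assumes "r > 0" shows "measure M (ball x r) > 0"
proof (rule ccontr)
  assume "\<not> ?thesis"
  then have 0: "measure M (ball x r) = 0"
    by (simp add: zero_less_measure_iff)
  have "emeasure M (ball x (2 ^ k * r)) = 0" for k
    using measure_ball_double_pow[OF assms, of x k] 0 by (simp add: emeasure_eq measure_le_0_iff)
  then have "emeasure M (\<Union>k. ball x (2 ^ k * r)) = 0"
    by (subst emeasure_UN_eq_0) auto
  moreover have "(\<Union>k. ball x (2 ^ k * r)) = UNIV"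
  proof -
    have "\<exists>k. dist x y < 2 ^ k * r" for y
    proof -
      obtain k where "dist x y / r < 2 ^ k"
        using real_arch_pow[of 2 "dist x y / r"] by auto
      then show ?thesis using assms by (auto simp: field_simps)
    qed
    then show ?thesis by auto
  qed
  ultimately show False using nonzero by simp
qed

text \<open>Doubling excludes atoms: the intervals \<open>S n\<close> to the right of x decrease to
  the empty set, yet each would carry a fixed share of an atom at x. Later this makes the kind of
  endpoint of an interval irrelevant.\<close>

lemma measure_point: "measure M {x} = 0"
proof (rule ccontr)
  assume "measure M {x} \<noteq> 0"
  then have pos: "measure M {x} > 0" by (simp add: zero_less_measure_iff)
  define S where "S n = {x<..<x + 3 / (real n + 1)}" for n :: nat
  have "(\<lambda>n. measure M (S n)) \<longlonglongrightarrow> measure M (\<Inter>n. S n)"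
  proof (rule Lim_measure_decseq)
    show "range S \<subseteq> sets M" by (auto simp: S_def)
    show "decseq S"
    proof (rule decseq_SucI)
      fix n
      have "3 / (real (Suc n) + 1) \<le> 3 / (real n + 1)" by (intro divide_left_mono) auto
      then show "S (Suc n) \<subseteq> S n" by (auto simp: S_def)
    qed
    show "emeasure M (S i) \<noteq> \<infinity>" for i
      using emeasure_bounded[of "S i"] by (auto simp: S_def)
  qed
  moreover have "(\<Inter>n. S n) = {}"
  proof (rule equals0I)
    fix y assume "y \<in> (\<Inter>n. S n)"
    then have y: "y \<in> S n" for n by blast
    then have "x < y" by (simp add: S_def)
    obtain n :: nat where "3 / (y - x) < n" using reals_Archimedean2 by blast
    then have "3 < (real n + 1) * (y - x)" using \<open>x < y\<close> by (simp add: field_simps)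
    then show False using y[of n] by (simp add: S_def field_simps)
  qed
  moreover have "measure M {x} / D \<le> measure M (S n)" for n
  proof -
    \<comment> \<open>With r a third of the length of \<open>S n\<close>, the ball of radius r
      around x + 1.5 r lies in \<open>S n\<close>, and its double contains x.\<close>
    define r where "r = 1 / (real n + 1)"
    have "r > 0" by (simp add: r_def)
    have "measure M {x} \<le> D ^ 1 * measure M (ball (x + 1.5 * r) r)"
      using \<open>r > 0\<close> by (intro measure_le_ball) (auto simp: dist_real_def)
    also have "measure M (ball (x + 1.5 * r) r) \<le> measure M (S n)"
    proof (intro measure_mono_bounded)
      have "S n = {x<..<x + 3 * r}" by (simp add: S_def r_def)
      then show "ball (x + 1.5 * r) r \<subseteq> S n" "bounded (S n)" "S n \<in> sets borel"
        using \<open>r > 0\<close> by (simp_all add: ball_eq_greaterThanLessThan greaterThanLessThan_subseteq_greaterThanLessThan)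
    qed simp
    finally show ?thesis using D_ge_1 by (simp add: field_simps)
  qed
  ultimately have "measure M {x} / D \<le> 0"
    by (intro LIMSEQ_le_const[of "\<lambda>n. measure M (S n)"]) auto
  then show False using pos D_ge_1 by (simp add: field_simps)
qed

lemma measure_Ico_pos: "a < b \<Longrightarrow> measure M {a..<b} > 0"
  using measure_mono_bounded[of "ball ((a + b) / 2) ((b - a) / 2)" "{a..<b}"]
    ball_pos[of "(b - a) / 2" "(a + b) / 2"]
  by (force simp: ball_eq_greaterThanLessThan field_simps)

lemma measure_Un_disjoint:
  assumes "bounded S" "bounded T" "S \<in> sets borel" "T \<in> sets borel" "S \<inter> T = {}"
  shows "measure M (S \<union> T) = measure M S + measure M T"
  using assms emeasure_bounded[of S] emeasure_bounded[of T] by (intro measure_Union) auto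

lemma measure_Ico_split:
  assumes "a \<le> m" "m \<le> b"
  shows "measure M {a..<b} = measure M {a..<m} + measure M {m..<b}"
proof -
  have "{a..<b} = {a..<m} \<union> {m..<b}" using assms by auto
  then show ?thesis
    by (simp add: measure_Un_disjoint[symmetric] ivl_disj_int_two)
qed

lemma integrable_bounded_supp:
  fixes f :: "real \<Rightarrow> real"
  assumes "f \<in> borel_measurable borel" "\<And>x. \<bar>f x\<bar> \<le> K" "\<And>x. x \<notin> S \<Longrightarrow> f x = 0" "bounded S" "S \<in> sets borel"
  shows "integrable M f"
proof (rule Bochner_Integration.integrable_bound)
  show "integrable M (\<lambda>x. K * indicator S x :: real)"
    using fmeas[OF assms(4,5)] by (intro integrable_mult_right integrable_real_indicator) (auto simp: fmeasurable_def)
  show "f \<in> borel_measurable M" using assms by simp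
  show "AE x in M. norm (f x) \<le> norm (K * indicator S x)"
    using assms(2,3) by (intro AE_I2) (auto simp: indicator_def intro: order_trans[OF _ abs_ge_self])
qed

lemma integral_le_measure:
  fixes f :: "real \<Rightarrow> real"
  assumes "f \<in> borel_measurable borel" "\<And>x. 0 \<le> f x" "\<And>x. f x \<le> indicator S x" "bounded S" "S \<in> sets borel"
  shows "integral\<^sup>L M f \<le> measure M S"
proof -
  have "integral\<^sup>L M f \<le> integral\<^sup>L M (indicator S)"
    using fmeas[OF assms(4,5)] assms(2,3)
    by (intro integral_mono integrable_bounded_supp[where K=1 and S=S])
      (auto simp: assms indicator_def intro: order_trans[OF assms(3)] antisym[OF order_trans[OF assms(3)] assms(2)])
  then show ?thesis by simp
qed

lemma measure_le_integral:
  fixes f :: "real \<Rightarrow> real"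
  assumes "integrable M f" "\<And>x. c * indicator S x \<le> f x" "bounded S" "S \<in> sets borel"
  shows "c * measure M S \<le> integral\<^sup>L M f"
proof -
  have "integral\<^sup>L M (\<lambda>x. c * indicator S x) \<le> integral\<^sup>L M f"
    using fmeas[OF assms(3,4)]
    by (intro integral_mono assms(1,2) integrable_mult_right integrable_real_indicator) (auto simp: fmeasurable_def)
  then show ?thesis by simp
qed

end

section \<open>Tents and the comparison of normalized integrals\<close>

definition tent :: "real \<Rightarrow> real \<Rightarrow> real \<Rightarrow> real" where
  "tent p r x = max 0 (1 - \<bar>x - p\<bar> / r)"

text \<open>The strict inequality places the jump so that combinations of tents and half-tents give
  indicators of half-open intervals exactly, endpoints included.\<close>

definition ltent :: "real \<Rightarrow> real \<Rightarrow> real \<Rightarrow> real" where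
  "ltent p r x = (if x < p then tent p r x else 0)"

lemma tent_nonneg [simp]: "0 \<le> tent p r x"
  by (simp add: tent_def)

lemma tent_le_1: "r > 0 \<Longrightarrow> tent p r x \<le> 1"
  by (simp add: tent_def)

lemma tent_outside: "r > 0 \<Longrightarrow> x \<notin> ball p r \<Longrightarrow> tent p r x = 0"
  by (auto simp: tent_def dist_real_def abs_minus_commute)

lemma ltent_nonneg [simp]: "0 \<le> ltent p r x"
  by (simp add: ltent_def)

lemma ltent_le_tent: "ltent p r x \<le> tent p r x"
  by (simp add: ltent_def)

lemma tent_measurable [measurable]: "tent p r \<in> borel_measurable borel"
  unfolding tent_def[abs_def] by measurable

lemma ltent_measurable [measurable]: "ltent p r \<in> borel_measurable borel"
  unfolding ltent_def[abs_def] by measurable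

lemma tent_lipschitz:
  assumes "r > 0" shows "\<bar>tent p r x - tent p r y\<bar> \<le> 1 / r * \<bar>x - y\<bar>"
proof -
  have "\<bar>tent p r x - tent p r y\<bar> \<le> \<bar>\<bar>x - p\<bar> / r - \<bar>y - p\<bar> / r\<bar>"
    unfolding tent_def by linarith
  also have "\<dots> = \<bar>\<bar>x - p\<bar> - \<bar>y - p\<bar>\<bar> / r"
    using assms by (simp add: diff_divide_distrib[symmetric] abs_divide)
  also have "\<dots> \<le> \<bar>x - y\<bar> / r"
    using assms by (intro divide_right_mono) linarith+
  finally show ?thesis by simp
qed

lemma tent_mono: "0 < r \<Longrightarrow> r \<le> s \<Longrightarrow> tent p r x \<le> tent p s x"
  unfolding tent_def by (intro max.mono order.refl diff_left_mono divide_left_mono) auto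

text \<open>The difference of two tents with the same centre vanishes at that centre, so cutting it
  there keeps it Lipschitz.\<close>

lemma ltent_diff_lipschitz:
  assumes "r > 0"
  shows "\<bar>(ltent p r x - ltent p (r / 2) x) - (ltent p r y - ltent p (r / 2) y)\<bar> \<le> 3 / r * \<bar>x - y\<bar>"
proof -
  define f where "f x = tent p r x - tent p (r / 2) x" for x
  have lip: "\<bar>f x - f y\<bar> \<le> 3 / r * \<bar>x - y\<bar>" for x y
  proof -
    have "3 / r * \<bar>x - y\<bar> = 1 / r * \<bar>x - y\<bar> + 1 / (r / 2) * \<bar>x - y\<bar>"
      by (simp add: field_simps)
    then show ?thesis
      using tent_lipschitz[of r p x y] tent_lipschitz[of "r / 2" p x y] assms
      unfolding f_def by (smt (verit) half_gt_zero)
  qed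
  have fp: "f p = 0" by (simp add: f_def tent_def)
  have cut: "\<bar>f x\<bar> \<le> 3 / r * \<bar>x - y\<bar>" if "x < p \<and> p \<le> y \<or> y < p \<and> p \<le> x" for x y
  proof -
    have "\<bar>f x\<bar> \<le> 3 / r * \<bar>x - p\<bar>" using lip[of x p] fp by simp
    also have "\<dots> \<le> 3 / r * \<bar>x - y\<bar>" using that assms by (intro mult_left_mono) auto
    finally show ?thesis .
  qed
  have eq: "ltent p r x - ltent p (r / 2) x = (if x < p then f x else 0)" for x
    by (simp add: ltent_def f_def)
  show ?thesis
    unfolding eq using lip[of x y] cut[of x y] cut[of y x]
    by (auto simp: abs_minus_commute not_less)
qed

section \<open>Tent integrals under a doubling measure\<close>

context doubling
begin

lemma tent_integrable: "r > 0 \<Longrightarrow> integrable M (tent p r)"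
  by (rule integrable_bounded_supp[where S="ball p r" and K=1])
     (auto simp: tent_le_1 tent_outside)

lemma ltent_integrable: "r > 0 \<Longrightarrow> integrable M (ltent p r)"
  by (rule integrable_bounded_supp[where S="ball p r" and K=1])
     (auto simp: ltent_def tent_le_1 tent_outside)

definition tent_int :: "real \<Rightarrow> real \<Rightarrow> real" where "tent_int p r = (\<integral>x. tent p r x \<partial>M)"
definition ltent_int :: "real \<Rightarrow> real \<Rightarrow> real" where "ltent_int p r = (\<integral>x. ltent p r x \<partial>M)"

lemma tent_int_le: "r > 0 \<Longrightarrow> tent_int p r \<le> measure M (ball p r)"
  unfolding tent_int_def by (intro integral_le_measure) (auto simp: indicator_def tent_le_1 tent_outside[simplified])

lemma tent_int_ge:
  assumes "r > 0" shows "1 / 2 * measure M (ball p (r / 2)) \<le> tent_int p r"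
  unfolding tent_int_def
proof (rule measure_le_integral[OF tent_integrable[OF assms]])
  show "1 / 2 * indicator (ball p (r / 2)) x \<le> tent p r x" for x
    using assms by (auto simp: indicator_def tent_def dist_real_def abs_minus_commute field_simps)
qed auto

text \<open>The exponent is k + 1 because the tent is at least 1/2 only on the ball of half the
  radius, which costs one more doubling.\<close>

lemma tent_int_ge_ball:
  assumes "r > 0" "S \<subseteq> ball p (2 ^ k * r)" "S \<in> sets borel"
  shows "measure M S \<le> 2 * D ^ (k + 1) * tent_int p r"
proof -
  have "measure M S \<le> D ^ (k + 1) * measure M (ball p (r / 2))"
    using assms by (intro measure_le_ball) auto
  also have "\<dots> \<le> D ^ (k + 1) * (2 * tent_int p r)"
    using tent_int_ge[OF assms(1), of p] D_ge_1 by (intro mult_left_mono) auto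
  finally show ?thesis by simp
qed

lemma tent_int_pos: "r > 0 \<Longrightarrow> tent_int p r > 0"
  using tent_int_ge[of r p] ball_pos[of "r / 2" p] by simp

lemma ltent_int_bounds: "r > 0 \<Longrightarrow> 0 \<le> ltent_int p r \<and> ltent_int p r \<le> tent_int p r"
  unfolding ltent_int_def tent_int_def
  by (auto intro!: integral_mono tent_integrable ltent_integrable simp: ltent_le_tent)

text \<open>Source of the contraction: near p + r/2 the wide tent exceeds the narrow one by a fixed
  amount, and by doubling a ball there holds a fixed share of the mass of
  \<open>ball p r\<close>.\<close>

lemma tent_int_half_le:
  assumes "r > 0" shows "tent_int p (r / 2) \<le> (1 - 3 / (16 * D ^ 5)) * tent_int p r"
proof -
  \<comment> \<open>With q = (x - p)/r in (3/8, 5/8), the difference of the tents is q up to q = 1/2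
    and 1 - q afterwards, hence above 3/8.\<close>
  have "3 / 8 * measure M (ball (p + r / 2) (r / 8)) \<le> (\<integral>x. tent p r x - tent p (r / 2) x \<partial>M)"
  proof (rule measure_le_integral)
    show "integrable M (\<lambda>x. tent p r x - tent p (r / 2) x)"
      using assms by (intro Bochner_Integration.integrable_diff tent_integrable) auto
    show "3 / 8 * indicator (ball (p + r / 2) (r / 8)) x \<le> tent p r x - tent p (r / 2) x" for x
    proof (cases "x \<in> ball (p + r / 2) (r / 8)")
      case True
      have x: "p + 3 / 8 * r < x" "x < p + 5 / 8 * r"
        using True by (auto simp: ball_eq_greaterThanLessThan)
      define q where "q = (x - p) / r"
      have "\<bar>x - p\<bar> = x - p" using x assms by linarith
      then have "tent p r x = max 0 (1 - q)" "tent p (r / 2) x = max 0 (1 - 2 * q)"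
        by (simp_all add: tent_def q_def mult.commute)
      moreover have "q > 3 / 8" "q < 5 / 8"
        using x assms by (auto simp: q_def field_simps)
      ultimately show ?thesis using True by (simp add: max_def)
    next
      case False
      then show ?thesis using tent_mono[of "r / 2" r p x] assms by simp
    qed
  qed auto
  also have "\<dots> = tent_int p r - tent_int p (r / 2)"
    unfolding tent_int_def using assms by (intro Bochner_Integration.integral_diff tent_integrable) auto
  finally have 1: "3 / 8 * measure M (ball (p + r / 2) (r / 8)) \<le> tent_int p r - tent_int p (r / 2)" .
  have "tent_int p r \<le> measure M (ball p r)" by (rule tent_int_le[OF assms])
  also have "\<dots> \<le> D ^ 4 * measure M (ball (p + r / 2) (r / 8))"
    using assms by (intro measure_le_ball) (auto simp: ball_eq_greaterThanLessThan)
  also have "\<dots> \<le> D ^ 5 * measure M (ball (p + r / 2) (r / 8))"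
    using D_ge_1 by (intro mult_right_mono power_increasing) auto
  finally have "tent_int p r / D ^ 5 \<le> measure M (ball (p + r / 2) (r / 8))"
    using D_ge_1 by (simp add: field_simps)
  then have "3 / 8 * (tent_int p r / D ^ 5) \<le> tent_int p r - tent_int p (r / 2)"
    using 1 by simp
  moreover have "3 / 16 * (tent_int p r / D ^ 5) \<le> 3 / 8 * (tent_int p r / D ^ 5)"
    using tent_int_pos[OF assms, of p] D_ge_1 by (intro mult_right_mono) auto
  ultimately show ?thesis by (simp add: field_simps)
qed

lemma normint_ball:
  assumes "t > 0"
  shows "normint M (ball y t) \<psi> =
    (\<integral>x. indicator (ball y t) x * \<psi> ((x - (y - t)) / (2 * t)) \<partial>M) / measure M (ball y t)"
  using assms by (simp add: normint_def set_lebesgue_integral_def T_int_def ball_eq_greaterThanLessThan)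

text \<open>A uniform bound over all tests makes the real supremum in \<open>alpha\<close> one over
  a bounded set, so that it really dominates each test.\<close>

lemma normint_bound:
  assumes "t > 0" "\<psi> \<in> W1_tests"
  shows "\<bar>normint M (ball y t) \<psi>\<bar> \<le> 2"
proof -
  have lip: "1-lipschitz_on UNIV \<psi>" and out: "\<And>s. s \<notin> {0..1} \<Longrightarrow> \<psi> s = 0"
    using assms by (auto simp: W1_tests_def)
  have m: "\<psi> \<in> borel_measurable borel"
    by (intro borel_measurable_continuous_onI lipschitz_on_continuous_on[OF lip])
  \<comment> \<open>The point -1 is a zero of \<psi> at distance at most 2 from every point of
    [0,1].\<close>
  have b: "\<bar>\<psi> s\<bar> \<le> 2" for s
    using lipschitz_onD[OF lip, of s "-1"] out[of "-1"] out[of s] by (cases "s \<in> {0..1}") (auto simp: dist_real_def)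
  let ?g = "\<lambda>x. indicator (ball y t) x * \<psi> ((x - (y - t)) / (2 * t))"
  have i: "integrable M ?g"
    using m b by (intro integrable_bounded_supp[where K=2 and S="ball y t"])
       (auto simp: indicator_def)
  have "\<bar>integral\<^sup>L M ?g\<bar> \<le> (\<integral>x. \<bar>?g x\<bar> \<partial>M)"
    by (rule integral_abs_bound)
  also have "\<dots> \<le> (\<integral>x. 2 * indicator (ball y t) x \<partial>M)"
    using i b fmeas[of "ball y t"]
    by (intro integral_mono integrable_abs integrable_mult_right integrable_real_indicator)
       (auto simp: indicator_def fmeasurable_def)
  also have "\<dots> = 2 * measure M (ball y t)" by simp
  finally have "\<bar>integral\<^sup>L M ?g\<bar> / measure M (ball y t) \<le> 2"
    using ball_pos[OF assms(1), of y] by (simp add: field_simps)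
  then show ?thesis
    by (simp add: normint_ball[OF assms(1)] abs_divide)
qed

end

section \<open>Comparing the two measures through alpha\<close>

locale doubling_pair = X: doubling \<mu> D + Y: doubling \<nu> D for \<mu> \<nu> D
begin

lemma alpha_upper:
  assumes "t > 0" "\<psi> \<in> W1_tests"
  shows "\<bar>normint \<mu> (ball y t) \<psi> - normint \<nu> (ball y t) \<psi>\<bar> \<le> alpha \<mu> \<nu> (ball y t)"
  unfolding alpha_def
proof (rule cSUP_upper[OF assms(2)])
  show "bdd_above ((\<lambda>\<psi>. \<bar>normint \<mu> (ball y t) \<psi> - normint \<nu> (ball y t) \<psi>\<bar>) ` W1_tests)"
  proof (rule bdd_aboveI2[where M=4])
    show "\<bar>normint \<mu> (ball y t) \<psi> - normint \<nu> (ball y t) \<psi>\<bar> \<le> 4" if "\<psi> \<in> W1_tests" for \<psi>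
      using X.normint_bound[OF assms(1) that, of y] Y.normint_bound[OF assms(1) that, of y] by linarith
  qed
qed

lemma alpha_nonneg: "t > 0 \<Longrightarrow> 0 \<le> alpha \<mu> \<nu> (ball y t)"
  using alpha_upper[of t "\<lambda>_. 0" y] by (force simp: W1_tests_def lipschitz_on_def)

text \<open>Pulling f back to [0,1] stretches its Lipschitz constant by the length 2t of the ball,
  so division by K gives an admissible test.\<close>

lemma alpha_test:
  assumes t: "t > 0" and K: "K > 0" "2 * t * L \<le> K"
    and lip: "\<And>x y. \<bar>f x - f y\<bar> \<le> L * \<bar>x - y\<bar>"
    and out: "\<And>x. x \<notin> ball y t \<Longrightarrow> f x = 0"
  shows "\<bar>(\<integral>x. f x \<partial>\<mu>) / measure \<mu> (ball y t) - (\<integral>x. f x \<partial>\<nu>) / measure \<nu> (ball y t)\<bar>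
    \<le> K * alpha \<mu> \<nu> (ball y t)"
proof -
  define \<psi> where "\<psi> s = f ((y - t) + 2 * t * s) / K" for s
  have "1-lipschitz_on UNIV \<psi>"
  proof (rule lipschitz_onI)
    show "dist (\<psi> s) (\<psi> s') \<le> 1 * dist s s'" for s s'
    proof -
      have "\<bar>f ((y - t) + 2 * t * s) - f ((y - t) + 2 * t * s')\<bar> \<le> L * \<bar>2 * t * s - 2 * t * s'\<bar>"
        using lip[of "(y - t) + 2 * t * s" "(y - t) + 2 * t * s'"] by simp
      also have "\<dots> = 2 * t * L * \<bar>s - s'\<bar>"
        using t by (simp add: right_diff_distrib[symmetric] abs_mult)
      also have "\<dots> \<le> K * \<bar>s - s'\<bar>" by (intro mult_right_mono K) auto
      finally show ?thesis
        using K by (simp add: \<psi>_def dist_real_def diff_divide_distrib[symmetric] abs_divide field_simps)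
    qed
  qed simp
  moreover have "\<psi> s = 0" if "s \<notin> {0..1}" for s
  proof -
    have "(y - t) + 2 * t * s \<notin> ball y t"
    proof
      assume "(y - t) + 2 * t * s \<in> ball y t"
      then have "0 < s * t" "t * s < t * 1" by (auto simp: ball_eq_greaterThanLessThan)
      then show False using that t by (auto simp: zero_less_mult_iff mult.commute)
    qed
    then show ?thesis by (simp add: \<psi>_def out)
  qed
  ultimately have W: "\<psi> \<in> W1_tests" by (auto simp: W1_tests_def)
  have *: "indicator (ball y t) x * \<psi> ((x - (y - t)) / (2 * t)) = f x / K" for x
    using t out[of x] by (auto simp: \<psi>_def indicator_def)
  let ?z = "(\<integral>x. f x \<partial>\<mu>) / measure \<mu> (ball y t) - (\<integral>x. f x \<partial>\<nu>) / measure \<nu> (ball y t)"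
  have "normint \<mu> (ball y t) \<psi> - normint \<nu> (ball y t) \<psi> = ?z / K"
    unfolding X.normint_ball[OF t] Y.normint_ball[OF t] * by (simp add: diff_divide_distrib mult.commute)
  then have "\<bar>?z\<bar> / K \<le> alpha \<mu> \<nu> (ball y t)"
    using alpha_upper[OF t W, of y] K by (simp add: abs_divide)
  then show ?thesis using K by (simp add: pos_divide_le_eq mult.commute)
qed

text \<open>The masses of the ball cancel in the quotients. Writing x/A - x'/A' = ((x - x') +
  (x'/A')(A' - A))/A makes the estimate asymmetric: \<mu> enters through the lower bound c for the
  denominator, \<nu> only through the bound K' for its own ratio.\<close>

lemma ratio_compare:
  assumes t: "t > 0" and K: "K > 0" "2 * t * L \<le> K"
    and f: "\<And>x y. \<bar>f x - f y\<bar> \<le> L * \<bar>x - y\<bar>" "\<And>x. x \<notin> ball y t \<Longrightarrow> f x = 0"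
    and b: "\<And>x y. \<bar>b x - b y\<bar> \<le> L * \<bar>x - y\<bar>" "\<And>x. x \<notin> ball y t \<Longrightarrow> b x = 0"
    and c: "c > 0" "c * measure \<mu> (ball y t) \<le> (\<integral>x. b x \<partial>\<mu>)"
    and \<nu>: "(\<integral>x. b x \<partial>\<nu>) > 0" "\<bar>\<integral>x. f x \<partial>\<nu>\<bar> \<le> K' * (\<integral>x. b x \<partial>\<nu>)"
  shows "\<bar>(\<integral>x. f x \<partial>\<mu>) / (\<integral>x. b x \<partial>\<mu>) - (\<integral>x. f x \<partial>\<nu>) / (\<integral>x. b x \<partial>\<nu>)\<bar>
    \<le> (1 + K') * K / c * alpha \<mu> \<nu> (ball y t)"
proof -
  define \<alpha> where "\<alpha> = alpha \<mu> \<nu> (ball y t)"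
  note pos = X.ball_pos[OF t, of y] Y.ball_pos[OF t, of y]
  define x x' A A' where
    "x = (\<integral>x. f x \<partial>\<mu>) / measure \<mu> (ball y t)" and "x' = (\<integral>x. f x \<partial>\<nu>) / measure \<nu> (ball y t)" and
    "A = (\<integral>x. b x \<partial>\<mu>) / measure \<mu> (ball y t)" and "A' = (\<integral>x. b x \<partial>\<nu>) / measure \<nu> (ball y t)"
  have 1: "\<bar>x - x'\<bar> \<le> K * \<alpha>" "\<bar>A - A'\<bar> \<le> K * \<alpha>"
    unfolding x_def x'_def A_def A'_def \<alpha>_def by (intro alpha_test[OF t K]; use f b in blast)+
  have A: "A \<ge> c" "A > 0" "A' > 0" using c \<nu> pos by (auto simp: A_def A'_def field_simps
      intro: less_le_trans[OF _ c(2)])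
  have eq: "(\<integral>x. f x \<partial>\<mu>) / (\<integral>x. b x \<partial>\<mu>) = x / A" "(\<integral>x. f x \<partial>\<nu>) / (\<integral>x. b x \<partial>\<nu>) = x' / A'"
    using pos by (auto simp: x_def x'_def A_def A'_def)
  have K': "\<bar>x' / A'\<bar> \<le> K'"
    using \<nu> pos by (auto simp: x'_def A'_def abs_divide field_simps)
  have "x / A - x' / A' = ((x - x') + (x' / A') * (A' - A)) / A"
    using A by (simp add: field_simps)
  then have "\<bar>x / A - x' / A'\<bar> = \<bar>(x - x') + (x' / A') * (A' - A)\<bar> / A"
    using A by (simp add: abs_divide)
  also have "\<dots> \<le> \<bar>(x - x') + (x' / A') * (A' - A)\<bar> / c"
    using A c by (intro divide_left_mono) auto
  also have "\<dots> \<le> (K * \<alpha> + K' * (K * \<alpha>)) / c"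
  proof (intro divide_right_mono)
    have "\<bar>(x' / A') * (A' - A)\<bar> \<le> K' * (K * \<alpha>)"
      unfolding abs_mult using K' 1 order_trans[OF abs_ge_zero K'] by (intro mult_mono) (auto simp: abs_minus_commute)
    then show "\<bar>(x - x') + (x' / A') * (A' - A)\<bar> \<le> K * \<alpha> + K' * (K * \<alpha>)"
      using 1 by linarith
  qed (use c in auto)
  finally show ?thesis unfolding eq \<alpha>_def by (simp add: field_simps)
qed

end

section \<open>One-sided tents and dyadic splitting ratios\<close>

context doubling_pair
begin

text \<open>The quantity to be controlled is how differently the two measures split at the point \<^term>\<open>p\<close>;
  \<^term>\<open>ltent\<close> is not Lipschitz at \<^term>\<open>p\<close>, so this is not directly bounded by one alpha-number.\<close>

definition e :: "real \<Rightarrow> real \<Rightarrow> real" where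
  "e p r = X.ltent_int p r / X.tent_int p r - Y.ltent_int p r / Y.tent_int p r"

text \<open>The weight makes sums over dyadic points comparable with the mass of \<mu>. Changing it
  from scale r to r/2 also uses up one of the two contraction factors that squaring
  produces.\<close>

definition E :: "real \<Rightarrow> real \<Rightarrow> real" where
  "E p r = (e p r)\<^sup>2 * X.tent_int p r"

text \<open>For dyadic intervals of different lengths the radius ranges are disjoint, so over a dyadic tree
  the regions on which these infima are taken do not overlap.\<close>

definition alpha_inf :: "real \<Rightarrow> real \<Rightarrow> real" where
  "alpha_inf a b = (INF yt\<in>{a..<b} \<times> {4 * (b - a)..<8 * (b - a)}. alpha \<mu> \<nu> (ball (fst yt) (snd yt)))"

abbreviation u :: "real \<Rightarrow> real \<Rightarrow> real" where "u a b \<equiv> measure \<mu> {a..<b}"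
abbreviation v :: "real \<Rightarrow> real \<Rightarrow> real" where "v a b \<equiv> measure \<nu> {a..<b}"

definition Delta :: "real \<Rightarrow> real \<Rightarrow> real" where
  "Delta a b = u a ((a + b) / 2) / u a b - v a ((a + b) / 2) / v a b"

lemma alpha_inf_le:
  assumes "y \<in> {a..<b}" "t \<in> {4 * (b - a)..<8 * (b - a)}"
  shows "alpha_inf a b \<le> alpha \<mu> \<nu> (ball y t)"
  unfolding alpha_inf_def
proof (rule cINF_lower2[where x="(y, t)"])
  show "bdd_below ((\<lambda>yt. alpha \<mu> \<nu> (ball (fst yt) (snd yt))) ` ({a..<b} \<times> {4 * (b - a)..<8 * (b - a)}))"
    using assms by (intro bdd_belowI2[where m=0]) (auto intro!: alpha_nonneg)
qed (use assms in auto)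

lemma alpha_inf_greatest:
  assumes "a < b" "K > 0"
    and "\<And>y t. y \<in> {a..<b} \<Longrightarrow> t \<in> {4 * (b - a)..<8 * (b - a)} \<Longrightarrow> c \<le> K * alpha \<mu> \<nu> (ball y t)"
  shows "c \<le> K * alpha_inf a b"
proof -
  have "c / K \<le> alpha_inf a b"
    unfolding alpha_inf_def using assms
    by (intro cINF_greatest) (auto simp: pos_divide_le_eq mult.commute)
  then show ?thesis using assms(2) by (simp add: pos_divide_le_eq mult.commute)
qed

lemma alpha_inf_nonneg: "a < b \<Longrightarrow> 0 \<le> alpha_inf a b"
  using alpha_inf_greatest[of a b 1 0] alpha_nonneg by force

text \<open>With h = b - a, every ball with centre in [a,b) and radius t >= 4h contains (a - 2h, b +
  2h), so f and g vanish off each of them; t < 8h gives 2t * (4/h) <= 64. The estimate thus holds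
  with every competing \<alpha>, hence with the infimum.\<close>

lemma ratio_alpha_inf:
  fixes f g :: "real \<Rightarrow> real"
  assumes ab: "a < b"
    and f: "\<And>x y. \<bar>f x - f y\<bar> \<le> 4 / (b - a) * \<bar>x - y\<bar>"
      "\<And>x. x \<notin> {a - 2 * (b - a)<..<b + 2 * (b - a)} \<Longrightarrow> f x = 0"
    and g: "\<And>x y. \<bar>g x - g y\<bar> \<le> 4 / (b - a) * \<bar>x - y\<bar>"
      "\<And>x. x \<notin> {a - 2 * (b - a)<..<b + 2 * (b - a)} \<Longrightarrow> g x = 0"
    and c: "c > 0" "\<And>y t. y \<in> {a..<b} \<Longrightarrow> t \<in> {4 * (b - a)..<8 * (b - a)} \<Longrightarrow>
      measure \<mu> (ball y t) \<le> c * (\<integral>x. g x \<partial>\<mu>)"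
    and \<nu>: "(\<integral>x. g x \<partial>\<nu>) > 0" "\<bar>\<integral>x. f x \<partial>\<nu>\<bar> \<le> K' * (\<integral>x. g x \<partial>\<nu>)" "K' \<ge> 0"
  shows "\<bar>(\<integral>x. f x \<partial>\<mu>) / (\<integral>x. g x \<partial>\<mu>) - (\<integral>x. f x \<partial>\<nu>) / (\<integral>x. g x \<partial>\<nu>)\<bar>
    \<le> (1 + K') * 64 * c * alpha_inf a b"
proof (rule alpha_inf_greatest[OF ab])
  show "(1 + K') * 64 * c > 0" using c \<nu> by simp
  fix y t assume y: "y \<in> {a..<b}" and t: "t \<in> {4 * (b - a)..<8 * (b - a)}"
  have tpos: "t > 0" using t ab by auto
  have sub: "{a - 2 * (b - a)<..<b + 2 * (b - a)} \<subseteq> ball y t"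
    using y t by (auto simp: ball_eq_greaterThanLessThan)
  have "2 * t * (4 / (b - a)) \<le> 64"
    using t ab by (simp add: field_simps)
  moreover have "1 / c * measure \<mu> (ball y t) \<le> (\<integral>x. g x \<partial>\<mu>)"
    using c(2)[OF y t] c(1) by (simp add: field_simps)
  ultimately have "\<bar>(\<integral>x. f x \<partial>\<mu>) / (\<integral>x. g x \<partial>\<mu>) - (\<integral>x. f x \<partial>\<nu>) / (\<integral>x. g x \<partial>\<nu>)\<bar>
      \<le> (1 + K') * 64 / (1 / c) * alpha \<mu> \<nu> (ball y t)"
    using sub c \<nu> tpos
    by (intro ratio_compare[where L="4 / (b - a)"] f g) auto
  then show "\<bar>(\<integral>x. f x \<partial>\<mu>) / (\<integral>x. g x \<partial>\<mu>) - (\<integral>x. f x \<partial>\<nu>) / (\<integral>x. g x \<partial>\<nu>)\<bar>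
      \<le> (1 + K') * 64 * c * alpha \<mu> \<nu> (ball y t)" by simp
qed

text \<open>Let P, P2 be the \<mu>-ratios at scales h and h/2, Q, Q2 those of \<nu>, and A, A' the
  quotients of the tent integrals. With F, G the integrals of the Lipschitz difference
  \<open>f\<close> over the tent integrals, P = F + A P2 and Q = G + A' Q2, so P - Q = (F - G) + A
  (P2 - Q2) + (A - A') Q2. The outer terms compare Lipschitz ratios, each costing 256 D^5
  \<open>alpha_inf a b\<close>.\<close>

lemma e_step:
  assumes ab: "a < b" and p: "p \<in> {a, b}"
  shows "\<bar>e p (b - a)\<bar> \<le> 512 * D ^ 5 * alpha_inf a b + X.tent_int p ((b - a) / 2) / X.tent_int p (b - a) * \<bar>e p ((b - a) / 2)\<bar>"
proof -
  define h where "h = b - a"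
  have h: "h > 0" "h / 2 > 0" using ab by (auto simp: h_def)
  define f where "f x = ltent p h x - ltent p (h / 2) x" for x
  note D1 = X.D_ge_1
  have lips: "1 / h * \<bar>x - y\<bar> \<le> 4 / h * \<bar>x - y\<bar>" "3 / h * \<bar>x - y\<bar> \<le> 4 / h * \<bar>x - y\<bar>"
      "1 / (h / 2) * \<bar>x - y\<bar> \<le> 4 / h * \<bar>x - y\<bar>" for x y
    using h by (auto intro!: mult_right_mono divide_right_mono simp: field_simps)
  have f_lip: "\<bar>f x - f y\<bar> \<le> 4 / h * \<bar>x - y\<bar>" for x y
    unfolding f_def using order_trans[OF ltent_diff_lipschitz[OF h(1)] lips(2)] .
  have t_lip: "\<bar>tent p h x - tent p h y\<bar> \<le> 4 / h * \<bar>x - y\<bar>"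
     "\<bar>tent p (h/2) x - tent p (h/2) y\<bar> \<le> 4 / h * \<bar>x - y\<bar>" for x y
    using order_trans[OF tent_lipschitz[OF h(1)] lips(1)] order_trans[OF tent_lipschitz[OF h(2)] lips(3)] .
  have out: "x \<notin> ball p h" "x \<notin> ball p (h / 2)" if "x \<notin> {a - 2 * h<..<b + 2 * h}" for x
    using that p h by (auto simp: ball_eq_greaterThanLessThan h_def field_simps)
  have f_bd: "0 \<le> f x" "f x \<le> tent p h x" for x
    using tent_mono[of "h / 2" h p x] h by (auto simp: f_def ltent_def)
  have f_int: "integral\<^sup>L \<mu> f = X.ltent_int p h - X.ltent_int p (h / 2)" "integral\<^sup>L \<nu> f = Y.ltent_int p h - Y.ltent_int p (h / 2)"
    unfolding f_def X.ltent_int_def Y.ltent_int_def using h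
    by (auto intro!: Bochner_Integration.integral_diff X.ltent_integrable Y.ltent_integrable)
  have f_int\<nu>: "0 \<le> integral\<^sup>L \<nu> f" "integral\<^sup>L \<nu> f \<le> Y.tent_int p h"
  proof -
    show "0 \<le> integral\<^sup>L \<nu> f" using f_bd by (intro Bochner_Integration.integral_nonneg) auto
    have "integrable \<nu> f"
      unfolding f_def using h by (intro Bochner_Integration.integrable_diff Y.ltent_integrable) auto
    then show "integral\<^sup>L \<nu> f \<le> Y.tent_int p h"
      unfolding Y.tent_int_def using f_bd h by (intro integral_mono Y.tent_integrable) auto
  qed
  have mono\<nu>: "Y.tent_int p (h / 2) \<le> Y.tent_int p h"
    unfolding Y.tent_int_def using h by (intro integral_mono Y.tent_integrable tent_mono) auto
  note pos = X.tent_int_pos[OF h(1), of p] X.tent_int_pos[OF h(2), of p] Y.tent_int_pos[OF h(1), of p] Y.tent_int_pos[OF h(2), of p]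
  \<comment> \<open>The distance from y to p is at most h and t < 8h, so radius 16h around p
    suffices: four doublings, plus one for the tent.\<close>
  have mass: "measure \<mu> (ball y t) \<le> 2 * D ^ 5 * X.tent_int p h"
    if "y \<in> {a..<b}" "t \<in> {4 * h..<8 * h}" for y t
  proof -
    have "ball y t \<subseteq> ball p (2 ^ 4 * h)"
      using that p h by (auto simp: ball_eq_greaterThanLessThan h_def)
    then show ?thesis using X.tent_int_ge_ball[of h "ball y t" p 4] h by simp
  qed
  have A: "\<bar>integral\<^sup>L \<mu> f / X.tent_int p h - integral\<^sup>L \<nu> f / Y.tent_int p h\<bar> \<le> (1 + 1) * 64 * (2 * D ^ 5) * alpha_inf a b"
    unfolding X.tent_int_def Y.tent_int_def
  proof (rule ratio_alpha_inf[OF ab, folded h_def])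
    show "f x = 0" if "x \<notin> {a - 2 * h<..<b + 2 * h}" for x
      using out[OF that] h by (simp add: f_def ltent_def tent_outside)
    show "tent p h x = 0" if "x \<notin> {a - 2 * h<..<b + 2 * h}" for x
      using out[OF that] h by (simp add: tent_outside)
    show "measure \<mu> (ball y t) \<le> 2 * D ^ 5 * integral\<^sup>L \<mu> (tent p h)"
      if "y \<in> {a..<b}" "t \<in> {4 * h..<8 * h}" for y t using mass[OF that] by (simp add: X.tent_int_def)
  qed (use f_lip t_lip D1 f_int\<nu> pos in \<open>auto simp: Y.tent_int_def\<close>)
  have B: "\<bar>X.tent_int p (h / 2) / X.tent_int p h - Y.tent_int p (h / 2) / Y.tent_int p h\<bar> \<le> (1 + 1) * 64 * (2 * D ^ 5) * alpha_inf a b"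
    unfolding X.tent_int_def Y.tent_int_def
  proof (rule ratio_alpha_inf[OF ab, folded h_def])
    show "tent p (h / 2) x = 0" "tent p h x = 0" if "x \<notin> {a - 2 * h<..<b + 2 * h}" for x
      using out[OF that] h by (simp_all add: tent_outside)
    show "measure \<mu> (ball y t) \<le> 2 * D ^ 5 * integral\<^sup>L \<mu> (tent p h)"
      if "y \<in> {a..<b}" "t \<in> {4 * h..<8 * h}" for y t using mass[OF that] by (simp add: X.tent_int_def)
  qed (use t_lip D1 mono\<nu> pos in \<open>auto simp: Y.tent_int_def\<close>)
  define P Q P2 Q2 A A' where "P = X.ltent_int p h / X.tent_int p h" and "Q = Y.ltent_int p h / Y.tent_int p h"
    and "P2 = X.ltent_int p (h / 2) / X.tent_int p (h / 2)" and "Q2 = Y.ltent_int p (h / 2) / Y.tent_int p (h / 2)"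
    and "A = X.tent_int p (h / 2) / X.tent_int p h" and "A' = Y.tent_int p (h / 2) / Y.tent_int p h"
  have PQ: "P = integral\<^sup>L \<mu> f / X.tent_int p h + A * P2" "Q = integral\<^sup>L \<nu> f / Y.tent_int p h + A' * Q2"
    using pos by (auto simp: P_def Q_def P2_def Q2_def A_def A'_def f_int field_simps)
  have Q2: "0 \<le> Q2" "Q2 \<le> 1"
    using Y.ltent_int_bounds[OF h(2), of p] pos by (auto simp: Q2_def)
  have "P - Q = (integral\<^sup>L \<mu> f / X.tent_int p h - integral\<^sup>L \<nu> f / Y.tent_int p h) + A * (P2 - Q2) + (A - A') * Q2"
    unfolding PQ by (simp add: algebra_simps)
  moreover have "\<bar>A * (P2 - Q2)\<bar> = A * \<bar>P2 - Q2\<bar>"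
    using pos by (simp add: abs_mult A_def)
  moreover have "\<bar>(A - A') * Q2\<bar> \<le> \<bar>A - A'\<bar>"
    using Q2 by (simp add: abs_mult mult_left_le)
  moreover have "\<bar>A - A'\<bar> \<le> 256 * D ^ 5 * alpha_inf a b"
    using B by (simp add: A_def A'_def)
  moreover have A': "\<bar>integral\<^sup>L \<mu> f / X.tent_int p h - integral\<^sup>L \<nu> f / Y.tent_int p h\<bar> \<le> 256 * D ^ 5 * alpha_inf a b"
    using A by simp
  ultimately have "\<bar>P - Q\<bar> \<le> 512 * D ^ 5 * alpha_inf a b + A * \<bar>P2 - Q2\<bar>"
    using A' by linarith
  then show ?thesis
    by (simp add: e_def P_def Q_def P2_def Q2_def A_def h_def)
qed

text \<open>The gain in \<open>tent_int_half_le\<close>.\<close>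

definition c0 :: real where "c0 = 3 / (16 * D ^ 5)"

lemma c0: "0 < c0" "c0 < 1" "0 \<le> 1 - c0\<^sup>2" "1 - c0\<^sup>2 < 1"
proof -
  have D5: "1 \<le> D ^ 5" using X.D_ge_1 by simp
  then have "3 < 16 * D ^ 5" "0 < D ^ 5" by linarith+
  then show c: "0 < c0" "c0 < 1" by (simp_all add: c0_def)
  then show "0 \<le> 1 - c0\<^sup>2" "1 - c0\<^sup>2 < 1" by (auto simp: power2_eq_square mult_le_one)
qed

lemma tent_int_le_u:
  assumes "a < b" "p \<in> {a, b}" shows "X.tent_int p (b - a) \<le> D\<^sup>2 * u a b"
proof -
  have "X.tent_int p (b - a) \<le> measure \<mu> (ball p (b - a))" using assms by (intro X.tent_int_le) auto
  also have "\<dots> \<le> D\<^sup>2 * measure \<mu> (ball ((a + b) / 2) ((b - a) / 2))"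
    using assms by (intro X.measure_le_ball) (auto simp: ball_eq_greaterThanLessThan field_simps)
  also have "\<dots> \<le> D\<^sup>2 * u a b"
    using assms X.D_ge_1 by (intro mult_left_mono X.measure_mono_bounded) (auto simp: ball_eq_greaterThanLessThan field_simps)
  finally show ?thesis .
qed

lemma E_nonneg: "r > 0 \<Longrightarrow> 0 \<le> E p r"
  unfolding E_def using X.tent_int_pos[of r p] by simp

lemma E_le_mt:
  assumes "r > 0" shows "E p r \<le> X.tent_int p r"
proof -
  have "0 \<le> X.ltent_int p r / X.tent_int p r" "X.ltent_int p r / X.tent_int p r \<le> 1" "0 \<le> Y.ltent_int p r / Y.tent_int p r" "Y.ltent_int p r / Y.tent_int p r \<le> 1"
    using X.ltent_int_bounds[OF assms, of p] X.tent_int_pos[OF assms, of p] Y.ltent_int_bounds[OF assms, of p] Y.tent_int_pos[OF assms, of p]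
    by auto
  then have "\<bar>e p r\<bar> \<le> 1" unfolding e_def by linarith
  then have "(e p r)\<^sup>2 \<le> 1" by (simp add: abs_square_le_1)
  then show ?thesis unfolding E_def using X.tent_int_pos[OF assms, of p] by (simp add: mult_left_le_one_le)
qed

text \<open>Young's inequality with weight c0 splits the square of \<open>e_step\<close>. In the
  term (1 + c0) (A y)^2 one factor A turns the weight into that of scale h/2; the other is at most 1
  - c0, which leaves (1 + c0)(1 - c0) < 1.\<close>

lemma E_step:
  assumes ab: "a < b" and p: "p \<in> {a, b}"
  shows "E p (b - a) \<le> (1 + 1 / c0) * (512 * D ^ 5)\<^sup>2 * D\<^sup>2 * ((alpha_inf a b)\<^sup>2 * u a b)
    + (1 - c0\<^sup>2) * E p ((b - a) / 2)"
proof -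
  define h where "h = b - a"
  have h: "h > 0" "h / 2 > 0" using ab by (auto simp: h_def)
  note pos = X.tent_int_pos[OF h(1), of p] X.tent_int_pos[OF h(2), of p]
  define A x y where "A = X.tent_int p (h / 2) / X.tent_int p h" and "x = 512 * D ^ 5 * alpha_inf a b" and "y = \<bar>e p (h / 2)\<bar>"
  have A: "0 \<le> A" "A \<le> 1 - c0"
    using X.tent_int_half_le[OF h(1), of p] pos by (auto simp: A_def c0_def divide_le_eq)
  have "\<bar>e p h\<bar> \<le> x + A * y"
    using e_step[OF assms] by (simp add: h_def A_def x_def y_def)
  then have "(e p h)\<^sup>2 \<le> (x + A * y)\<^sup>2"
    by (metis abs_ge_zero power2_abs power_mono)
  also have "\<dots> \<le> (1 + 1 / c0) * x\<^sup>2 + (1 + c0) * (A * y)\<^sup>2"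
  proof -
    have "(1 + 1 / c0) * x\<^sup>2 + (1 + c0) * (A * y)\<^sup>2 - (x + A * y)\<^sup>2 = (x - c0 * (A * y))\<^sup>2 / c0"
      using c0 by (simp add: power2_eq_square field_simps)
    also have "\<dots> \<ge> 0" using c0 by simp
    finally show ?thesis by simp
  qed
  finally have "E p h \<le> ((1 + 1 / c0) * x\<^sup>2 + (1 + c0) * (A * y)\<^sup>2) * X.tent_int p h"
    unfolding E_def using pos by (intro mult_right_mono) auto
  also have "\<dots> = (1 + 1 / c0) * x\<^sup>2 * X.tent_int p h + (1 + c0) * A * E p (h / 2)"
    using pos by (simp add: E_def A_def y_def power2_eq_square field_simps)
  also have "\<dots> \<le> (1 + 1 / c0) * x\<^sup>2 * (D\<^sup>2 * u a b) + (1 + c0) * (1 - c0) * E p (h / 2)"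
    using c0 A tent_int_le_u[OF ab p] E_nonneg[OF h(2), of p]
    by (intro add_mono mult_left_mono mult_right_mono) (auto simp: h_def)
  also have "\<dots> = (1 + 1 / c0) * (512 * D ^ 5)\<^sup>2 * D\<^sup>2 * ((alpha_inf a b)\<^sup>2 * u a b) + (1 - c0\<^sup>2) * E p (h / 2)"
    by (simp add: x_def power2_eq_square algebra_simps)
  finally show ?thesis by (simp add: h_def)
qed

text \<open>Tents of radius r = (b - a)/2 centred at a, m and b express both [a,b) and [a,m). Each
  tent costs one alpha term k, and each half-tent costs k plus an \<open>e\<close>-term for its
  jump.\<close>

lemma Delta_bound:
  assumes ab: "a < b"
  shows "\<bar>Delta a b\<bar> \<le> D\<^sup>2 * (7 * (384 * D ^ 4 * alpha_inf a b) +
    4 * (\<bar>e a ((b - a) / 2)\<bar> + \<bar>e ((a + b) / 2) ((b - a) / 2)\<bar> + \<bar>e b ((b - a) / 2)\<bar>))"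
proof -
  define m r where "m = (a + b) / 2" and "r = (b - a) / 2"
  have eqs: "b = m + r" "a = m - r" "b - a = 2 * r" and r: "r > 0"
    using ab by (auto simp: m_def r_def field_simps)
  \<comment> \<open>A common Lipschitz denominator: it is at least 1/2 on
    \<open>ball m (2 * r)\<close>, which contains the supports of all the small tents.\<close>
  define N where "N = tent m (4 * r)"
  define nX nY where "nX = X.tent_int m (4 * r)" and "nY = Y.tent_int m (4 * r)"
  have nint: "integral\<^sup>L \<mu> N = nX" "integral\<^sup>L \<nu> N = nY"
    by (auto simp: N_def nX_def nY_def X.tent_int_def Y.tent_int_def)
  note D1 = X.D_ge_1
  note npos = X.tent_int_pos[of "4 * r" m, folded nX_def] Y.tent_int_pos[of "4 * r" m, folded nY_def]
  have N_lip: "\<bar>N x - N y\<bar> \<le> 4 / (2 * r) * \<bar>x - y\<bar>" for x y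
  proof -
    have "1 / (4 * r) * \<bar>x - y\<bar> \<le> 4 / (2 * r) * \<bar>x - y\<bar>"
      using r by (intro mult_right_mono) (auto simp: field_simps)
    then show ?thesis
      unfolding N_def using tent_lipschitz[of "4 * r" m x y] r by linarith
  qed
  have t_lip: "\<bar>tent p r x - tent p r y\<bar> \<le> 4 / (2 * r) * \<bar>x - y\<bar>" for x y p
  proof -
    have "1 / r * \<bar>x - y\<bar> \<le> 4 / (2 * r) * \<bar>x - y\<bar>"
      using r by (intro mult_right_mono) (auto simp: field_simps)
    then show ?thesis
      using tent_lipschitz[of r p x y] r by linarith
  qed
  have mass: "measure \<mu> (ball y t) \<le> 2 * D ^ 4 * nX"
    if "y \<in> {m - r..<m + r}" "t \<in> {4 * (2 * r)..<8 * (2 * r)}" for y t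
  proof -
    have "ball y t \<subseteq> ball m (2 ^ 3 * (4 * r))"
      using that r by (auto simp: ball_eq_greaterThanLessThan)
    then show ?thesis using X.tent_int_ge_ball[of "4 * r" "ball y t" m 3] r by (simp add: nX_def)
  qed
  have le_N: "tent p r x \<le> 2 * N x" if "p \<in> {m - r, m, m + r}" for p x
  proof (cases "x \<in> ball m (2 * r)")
    case True
    then have "N x \<ge> 1 / 2"
      using r by (auto simp: N_def tent_def dist_real_def abs_minus_commute field_simps)
    then show ?thesis using tent_le_1[OF r, of p x] by linarith
  next
    case False
    then have "x \<notin> ball p r" using that r by (auto simp: ball_eq_greaterThanLessThan)
    then show ?thesis using tent_outside[OF r] by (simp add: N_def)
  qed
  have tent_int_le_n: "X.tent_int p r \<le> 2 * nX" "Y.tent_int p r \<le> 2 * nY" if "p \<in> {m - r, m, m + r}" for p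
  proof -
    have "integral\<^sup>L \<mu> (tent p r) \<le> integral\<^sup>L \<mu> (\<lambda>x. 2 * N x)"
      using r le_N[OF that] unfolding N_def
      by (intro integral_mono X.tent_integrable integrable_mult_right) auto
    then show "X.tent_int p r \<le> 2 * nX" by (simp add: X.tent_int_def nint)
    have "integral\<^sup>L \<nu> (tent p r) \<le> integral\<^sup>L \<nu> (\<lambda>x. 2 * N x)"
      using r le_N[OF that] unfolding N_def
      by (intro integral_mono Y.tent_integrable integrable_mult_right) auto
    then show "Y.tent_int p r \<le> 2 * nY" by (simp add: Y.tent_int_def nint)
  qed
  define k where "k = 384 * D ^ 4 * alpha_inf a b"
  have k: "\<bar>X.tent_int p r / nX - Y.tent_int p r / nY\<bar> \<le> k" if p: "p \<in> {m - r, m, m + r}" for p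
  proof -
    have "\<bar>X.tent_int p r / nX - Y.tent_int p r / nY\<bar> \<le> (1 + 2) * 64 * (2 * D ^ 4) * alpha_inf a b"
      unfolding X.tent_int_def Y.tent_int_def nint[symmetric]
    proof (rule ratio_alpha_inf[OF ab, unfolded eqs(3)])
      show "tent p r x = 0" "N x = 0" if "x \<notin> {a - 2 * (2 * r)<..<b + 2 * (2 * r)}" for x
        using that p r unfolding eqs N_def by (auto intro!: tent_outside simp: ball_eq_greaterThanLessThan)
      show "measure \<mu> (ball y t) \<le> 2 * D ^ 4 * integral\<^sup>L \<mu> N"
        if "y \<in> {a..<b}" "t \<in> {4 * (2 * r)..<8 * (2 * r)}" for y t
        using mass[of y t] that by (simp add: nint eqs)
      show "\<bar>integral\<^sup>L \<nu> (tent p r)\<bar> \<le> 2 * integral\<^sup>L \<nu> N"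
        using tent_int_le_n[OF p] Y.tent_int_pos[OF r, of p] by (simp add: Y.tent_int_def nint)
      show "0 < integral\<^sup>L \<nu> N" using npos r by (simp add: nint)
    qed (use D1 N_lip t_lip in auto)
    then show ?thesis by (simp add: k_def)
  qed
  have l: "\<bar>X.ltent_int p r / nX - Y.ltent_int p r / nY\<bar> \<le> k + 2 * \<bar>e p r\<bar>" if p: "p \<in> {m - r, m, m + r}" for p
  proof -
    define A A' P P' where "A = X.tent_int p r / nX" and "A' = Y.tent_int p r / nY"
      and "P = X.ltent_int p r / X.tent_int p r" and "P' = Y.ltent_int p r / Y.tent_int p r"
    have pos: "X.tent_int p r > 0" "Y.tent_int p r > 0" using X.tent_int_pos[OF r] Y.tent_int_pos[OF r] by auto
    have P': "0 \<le> P'" "P' \<le> 1" using Y.ltent_int_bounds[OF r, of p] pos by (auto simp: P'_def)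
    have A: "0 \<le> A" "A \<le> 2" using tent_int_le_n[OF p] pos npos r by (auto simp: A_def divide_le_eq)
    have "X.ltent_int p r / nX - Y.ltent_int p r / nY = A * (P - P') + (A - A') * P'"
      using pos npos r by (simp add: A_def A'_def P_def P'_def field_simps)
    moreover have "\<bar>A * (P - P')\<bar> \<le> 2 * \<bar>e p r\<bar>"
      unfolding abs_mult using A by (intro mult_mono) (auto simp: e_def P_def P'_def)
    moreover have "\<bar>(A - A') * P'\<bar> \<le> k"
      using P' k[OF p] mult_left_le[of P' "\<bar>A - A'\<bar>"] by (auto simp: abs_mult A_def A'_def)
    ultimately show ?thesis by linarith
  qed
  \<comment> \<open>The right half-tent at a, the tent at m and the left half-tent at b sum to 1 on
    [a,b); for [a,m) the left half-tent at m closes the sum.\<close>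
  have ind: "indicator {a..<b} x = (tent a r x - ltent a r x) + tent m r x + ltent b r x"
    "indicator {a..<m} x = (tent a r x - ltent a r x) + ltent m r x" for x
  proof -
    consider "x < a" | "a \<le> x" "x < m" | "m \<le> x" "x < b" | "b \<le> x" by linarith
    then show "indicator {a..<b} x = (tent a r x - ltent a r x) + tent m r x + ltent b r x"
    "indicator {a..<m} x = (tent a r x - ltent a r x) + ltent m r x"
      using r by (cases; simp add: eqs ltent_def tent_def indicator_def field_simps max_def)+
  qed
  have uX: "u a b = (X.tent_int a r - X.ltent_int a r) + X.tent_int m r + X.ltent_int b r"
    "u a m = (X.tent_int a r - X.ltent_int a r) + X.ltent_int m r"
  proof -
    have "u a b = integral\<^sup>L \<mu> (indicator {a..<b})" "u a m = integral\<^sup>L \<mu> (indicator {a..<m})" by simp_all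
    then show "u a b = (X.tent_int a r - X.ltent_int a r) + X.tent_int m r + X.ltent_int b r"
      "u a m = (X.tent_int a r - X.ltent_int a r) + X.ltent_int m r"
      unfolding ind by (simp_all add: X.tent_int_def X.ltent_int_def X.tent_integrable X.ltent_integrable r)
  qed
  have uY: "v a b = (Y.tent_int a r - Y.ltent_int a r) + Y.tent_int m r + Y.ltent_int b r"
    "v a m = (Y.tent_int a r - Y.ltent_int a r) + Y.ltent_int m r"
  proof -
    have "v a b = integral\<^sup>L \<nu> (indicator {a..<b})" "v a m = integral\<^sup>L \<nu> (indicator {a..<m})" by simp_all
    then show "v a b = (Y.tent_int a r - Y.ltent_int a r) + Y.tent_int m r + Y.ltent_int b r"
      "v a m = (Y.tent_int a r - Y.ltent_int a r) + Y.ltent_int m r"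
      unfolding ind by (simp_all add: Y.tent_int_def Y.ltent_int_def Y.tent_integrable Y.ltent_integrable r)
  qed
  define U U1 V V1 where "U = u a b / nX" and "U1 = u a m / nX" and "V = v a b / nY" and "V1 = v a m / nY"
  \<comment> \<open>Four pieces make up [a,b) and three make up [a,m), which gives the 7 k in the
    final bound.\<close>
  have UV: "\<bar>U - V\<bar> \<le> 4 * k + 2 * \<bar>e a r\<bar> + 2 * \<bar>e b r\<bar>"
    using k[of a] k[of m] l[of a] l[of b] unfolding U_def V_def uX uY add_divide_distrib diff_divide_distrib
    by (auto simp: eqs)
  have UV1: "\<bar>U1 - V1\<bar> \<le> 3 * k + 2 * \<bar>e a r\<bar> + 2 * \<bar>e m r\<bar>"
    using k[of a] l[of a] l[of m] unfolding U1_def V1_def uX uY add_divide_distrib diff_divide_distrib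
    by (auto simp: eqs)
  have upos: "u a b > 0" "v a b > 0" using X.measure_Ico_pos[OF ab] Y.measure_Ico_pos[OF ab] .
  have "nX \<le> measure \<mu> (ball m (4 * r))" unfolding nX_def using r by (intro X.tent_int_le) auto
  also have "\<dots> \<le> D\<^sup>2 * measure \<mu> (ball m r)"
    using r by (intro X.measure_le_ball) auto
  also have "\<dots> \<le> D\<^sup>2 * u a b"
    using r by (intro mult_left_mono X.measure_mono_bounded) (auto simp: ball_eq_greaterThanLessThan eqs)
  finally have "1 \<le> D\<^sup>2 * U" using npos r by (simp add: U_def field_simps)
  moreover have Upos: "U > 0" using upos npos r by (simp add: U_def)
  ultimately have U: "1 / U \<le> D\<^sup>2" by (simp add: pos_divide_le_eq)
  have V1: "0 \<le> V1 / V" "V1 / V \<le> 1"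
  proof -
    have "v a m \<le> v a b" using r by (intro Y.measure_mono_bounded) (auto simp: eqs)
    then show "0 \<le> V1 / V" "V1 / V \<le> 1" using upos npos r by (auto simp: V_def V1_def)
  qed
  have "Delta a b = U1 / U - V1 / V"
    using npos r by (simp add: Delta_def m_def[symmetric] U_def U1_def V_def V1_def)
  also have "\<dots> = ((U1 - V1) - (V1 / V) * (U - V)) * (1 / U)"
    using Upos upos npos r by (simp add: V_def field_simps)
  finally have "\<bar>Delta a b\<bar> = \<bar>(U1 - V1) - (V1 / V) * (U - V)\<bar> * (1 / U)"
    using Upos by (simp add: abs_mult)
  also have "\<dots> \<le> (\<bar>U1 - V1\<bar> + \<bar>U - V\<bar>) * D\<^sup>2"
  proof (rule mult_mono)
    have "\<bar>(V1 / V) * (U - V)\<bar> \<le> \<bar>U - V\<bar>"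
    proof -
      have "\<bar>w * z\<bar> \<le> \<bar>z\<bar>" if "0 \<le> w" "w \<le> 1" for w z :: real
        using that by (simp add: abs_mult mult_left_le_one_le)
      from this[OF V1] show ?thesis .
    qed
    then show "\<bar>(U1 - V1) - (V1 / V) * (U - V)\<bar> \<le> \<bar>U1 - V1\<bar> + \<bar>U - V\<bar>" by linarith
  qed (use U Upos in auto)
  also have "\<dots> \<le> (7 * k + 4 * (\<bar>e a r\<bar> + \<bar>e m r\<bar> + \<bar>e b r\<bar>)) * D\<^sup>2"
    by (rule mult_right_mono[OF order_trans[OF add_mono[OF UV1 UV]]]) simp_all
  finally show ?thesis by (simp add: k_def m_def r_def mult.commute)
qed

text \<open>The midpoint term is doubled because the midpoint is an endpoint of both halves: the
  bracket is then exactly the endpoint errors of the two children at their own length, which sums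
  along the tree.\<close>

lemma Delta_E:
  obtains K where "K \<ge> 0" "\<And>a b. a < b \<Longrightarrow> (Delta a b)\<^sup>2 * u a b \<le>
    K * ((alpha_inf a b)\<^sup>2 * u a b + (E a ((b - a) / 2) + 2 * E ((a + b) / 2) ((b - a) / 2) + E b ((b - a) / 2)))"
proof
  define k1 k2 where "k1 = D\<^sup>2 * (7 * (384 * D ^ 4))" and "k2 = D\<^sup>2 * 4"
  define K where "K = 4 * k1\<^sup>2 + 4 * k2\<^sup>2 * (2 * D ^ 3)"
  have D1: "D \<ge> 1" by (rule X.D_ge_1)
  show "0 \<le> K" using D1 by (simp add: K_def)
  fix a b :: real assume ab: "a < b"
  define m r where "m = (a + b) / 2" and "r = (b - a) / 2"
  have r: "r > 0" using ab by (simp add: r_def)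
  have um: "u a b \<le> 2 * D ^ 3 * X.tent_int p r" if "p \<in> {a, m, b}" for p
  proof -
    have "{a..<b} \<subseteq> ball p (2 ^ 2 * r)"
      using that ab by (auto simp: ball_eq_greaterThanLessThan m_def r_def field_simps)
    from X.tent_int_ge_ball[OF r this] show ?thesis by simp
  qed
  have eu: "(e p r)\<^sup>2 * u a b \<le> 2 * D ^ 3 * E p r" if "p \<in> {a, m, b}" for p
    using mult_left_mono[OF um[OF that], of "(e p r)\<^sup>2"] by (simp add: E_def mult_ac)
  have Epos: "E p r \<ge> 0" for p using E_nonneg[OF r] .
  have sq4: "(x + y + z + w)\<^sup>2 \<le> 4 * x\<^sup>2 + 4 * y\<^sup>2 + 4 * z\<^sup>2 + 4 * w\<^sup>2" for x y z w :: real
  proof -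
    have "4 * x\<^sup>2 + 4 * y\<^sup>2 + 4 * z\<^sup>2 + 4 * w\<^sup>2 - (x + y + z + w)\<^sup>2 =
      (x - y)\<^sup>2 + (x - z)\<^sup>2 + (x - w)\<^sup>2 + (y - z)\<^sup>2 + (y - w)\<^sup>2 + (z - w)\<^sup>2"
      by (simp add: power2_eq_square algebra_simps)
    also have "\<dots> \<ge> 0" by (intro add_nonneg_nonneg) auto
    finally show ?thesis by simp
  qed
  have "\<bar>Delta a b\<bar> \<le> k1 * alpha_inf a b + k2 * \<bar>e a r\<bar> + k2 * \<bar>e m r\<bar> + k2 * \<bar>e b r\<bar>"
  proof -
    have "D\<^sup>2 * (7 * (384 * D ^ 4 * s) + 4 * (x + y + z)) = k1 * s + k2 * x + k2 * y + k2 * z" for s x y z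
      by (simp only: k1_def k2_def distrib_left mult.assoc add.assoc)
    then show ?thesis using Delta_bound[OF ab] by (simp only: m_def r_def)
  qed
  then have "(Delta a b)\<^sup>2 \<le> (k1 * alpha_inf a b + k2 * \<bar>e a r\<bar> + k2 * \<bar>e m r\<bar> + k2 * \<bar>e b r\<bar>)\<^sup>2"
    by (metis abs_ge_zero power2_abs power_mono)
  also have "\<dots> \<le> 4 * k1\<^sup>2 * (alpha_inf a b)\<^sup>2 + 4 * k2\<^sup>2 * ((e a r)\<^sup>2 + (e m r)\<^sup>2 + (e b r)\<^sup>2)"
    using sq4[of "k1 * alpha_inf a b" "k2 * \<bar>e a r\<bar>" "k2 * \<bar>e m r\<bar>" "k2 * \<bar>e b r\<bar>"]
    by (simp add: power_mult_distrib algebra_simps)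
  finally have "(Delta a b)\<^sup>2 * u a b \<le>
     (4 * k1\<^sup>2 * (alpha_inf a b)\<^sup>2 + 4 * k2\<^sup>2 * ((e a r)\<^sup>2 + (e m r)\<^sup>2 + (e b r)\<^sup>2)) * u a b"
    by (rule mult_right_mono) auto
  also have "\<dots> = 4 * k1\<^sup>2 * ((alpha_inf a b)\<^sup>2 * u a b) + 4 * k2\<^sup>2 * ((e a r)\<^sup>2 * u a b + (e m r)\<^sup>2 * u a b + (e b r)\<^sup>2 * u a b)"
    by (simp add: algebra_simps)
  also have "\<dots> \<le> 4 * k1\<^sup>2 * ((alpha_inf a b)\<^sup>2 * u a b) + 4 * k2\<^sup>2 * (2 * D ^ 3 * E a r + 2 * D ^ 3 * E m r + 2 * D ^ 3 * E b r)"
    by (intro add_mono mult_left_mono eu order.refl) auto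
  also have "\<dots> = 4 * k1\<^sup>2 * ((alpha_inf a b)\<^sup>2 * u a b) + 4 * k2\<^sup>2 * (2 * D ^ 3) * (E a r + E m r + E b r)"
    by (simp add: algebra_simps)
  also have "\<dots> \<le> K * ((alpha_inf a b)\<^sup>2 * u a b) + K * (E a r + 2 * E m r + E b r)"
    using D1 Epos[of a] Epos[of b] Epos[of m] by (intro add_mono mult_mono) (auto simp: K_def)
  finally show "(Delta a b)\<^sup>2 * u a b \<le>
    K * ((alpha_inf a b)\<^sup>2 * u a b + (E a ((b - a) / 2) + 2 * E ((a + b) / 2) ((b - a) / 2) + E b ((b - a) / 2)))"
    by (simp add: m_def r_def distrib_left)
qed

end

section \<open>Carleson packing over dyadic trees\<close>

primrec tree_sum :: "nat \<Rightarrow> (real \<Rightarrow> real \<Rightarrow> real) \<Rightarrow> real \<Rightarrow> real \<Rightarrow> real" where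
  "tree_sum 0 \<phi> a b = \<phi> a b"
| "tree_sum (Suc n) \<phi> a b = tree_sum n \<phi> a ((a + b) / 2) + tree_sum n \<phi> ((a + b) / 2) b"

text \<open>The recursion splits at the root; this form splits at the leaves, so that a bound by the
  children of an interval becomes a sum over the next generation.\<close>

lemma tree_sum_Suc':
  "tree_sum (Suc n) \<phi> a b = tree_sum n (\<lambda>a b. \<phi> a ((a + b) / 2) + \<phi> ((a + b) / 2) b) a b"
  by (induction n arbitrary: a b) simp_all

lemma tree_sum_mono:
  assumes "\<And>a b. a < b \<Longrightarrow> \<phi> a b \<le> \<psi> a b" "a < b"
  shows "tree_sum n \<phi> a b \<le> tree_sum n \<psi> a b"
  using assms(2)
proof (induction n arbitrary: a b)
  case (Suc n)
  then show ?case by (auto intro!: add_mono Suc.IH)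
qed (simp add: assms(1))

lemma tree_sum_add: "tree_sum n (\<lambda>a b. \<phi> a b + \<psi> a b) a b = tree_sum n \<phi> a b + tree_sum n \<psi> a b"
  by (induction n arbitrary: a b) simp_all

lemma tree_sum_cmult: "tree_sum n (\<lambda>a b. c * \<phi> a b) a b = c * tree_sum n \<phi> a b"
  by (induction n arbitrary: a b) (simp_all add: distrib_left)

lemma tree_sum_nonneg:
  assumes "\<And>a b. a < b \<Longrightarrow> 0 \<le> \<phi> a b" "a < b" shows "0 \<le> tree_sum n \<phi> a b"
  using tree_sum_mono[of "\<lambda>_ _. 0" \<phi> a b n] assms tree_sum_cmult[of n 0 "\<lambda>_ _. 0" a b] by simp

definition tree_total :: "nat \<Rightarrow> (real \<Rightarrow> real \<Rightarrow> real) \<Rightarrow> real \<Rightarrow> real \<Rightarrow> real" where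
  "tree_total n \<phi> a b = (\<Sum>k<n. tree_sum k \<phi> a b)"

lemma tree_total_0 [simp]: "tree_total 0 \<phi> a b = 0"
  by (simp add: tree_total_def)

lemma tree_total_Suc:
  "tree_total (Suc n) \<phi> a b =
    \<phi> a b + tree_total n \<phi> a ((a + b) / 2) + tree_total n \<phi> ((a + b) / 2) b"
  unfolding tree_total_def by (subst sum.lessThan_Suc_shift) (simp add: sum.distrib)

lemma (in doubling) tree_sum_measure:
  "a < b \<Longrightarrow> tree_sum n (\<lambda>a b. measure M {a..<b}) a b = measure M {a..<b}"
proof (induction n arbitrary: a b)
  case (Suc n)
  then show ?case using measure_Ico_split[of a "(a + b) / 2" b] by simp
qed simp

section \<open>Packing of the alpha numbers and of the splitting differences\<close>

locale carleson_pair = doubling_pair +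
  fixes C :: real
  assumes C_ge_1: "C \<ge> 1"
    and carleson: "r > 0 \<Longrightarrow> (\<integral>\<^sup>+ y\<in>ball x (2 * r). (\<integral>\<^sup>+ t\<in>{0<..<2 * r}.
          ennreal ((alpha \<mu> \<nu> (ball y t))\<^sup>2 / t) \<partial>lborel) \<partial>\<mu>)
        \<le> ennreal C * emeasure \<mu> (ball x r)"
begin

text \<open>A measurable minorant of the inner integral of the hypothesis; working with it avoids any
  measurability of \<^term>\<open>alpha\<close> in the centre and the radius.\<close>

primrec w :: "nat \<Rightarrow> real \<Rightarrow> real \<Rightarrow> real \<Rightarrow> real" where
  "w 0 a b y = 0"
| "w (Suc n) a b y = (alpha_inf a b)\<^sup>2 / 2 * indicator {a..<b} y
     + (w n a ((a + b) / 2) y + w n ((a + b) / 2) b y)"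

lemma w_nonneg: "0 \<le> w n a b y"
  by (induction n arbitrary: a b) auto

lemma w_measurable [measurable]: "w n a b \<in> borel_measurable borel"
proof (induction n arbitrary: a b)
  case 0
  have "w 0 a b = (\<lambda>_. 0)" by auto
  then show ?case by simp
next
  case (Suc n)
  note Suc[measurable]
  have "w (Suc n) a b = (\<lambda>y. (alpha_inf a b)\<^sup>2 / 2 * indicator {a..<b} y
     + (w n a ((a + b) / 2) y + w n ((a + b) / 2) b y))" by auto
  then show ?case by simp
qed

lemma w_outside: "a < b \<Longrightarrow> y \<notin> {a..<b} \<Longrightarrow> w n a b y = 0"
  by (induction n arbitrary: a b) auto

lemma nn_integral_w:
  "a < b \<Longrightarrow> (\<integral>\<^sup>+ y. ennreal (w n a b y) \<partial>\<mu>) = ennreal (tree_total n (\<lambda>a b. (alpha_inf a b)\<^sup>2 * u a b) a b / 2)"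
proof (induction n arbitrary: a b)
  case (Suc n)
  let ?T = "tree_total n (\<lambda>a b. (alpha_inf a b)\<^sup>2 * u a b)"
  have T: "?T a b \<ge> 0" if "a < b" for a b
    unfolding tree_total_def using that by (intro sum_nonneg tree_sum_nonneg) auto
  have "(\<integral>\<^sup>+ y. ennreal (w (Suc n) a b y) \<partial>\<mu>) =
     (\<integral>\<^sup>+ y. ennreal ((alpha_inf a b)\<^sup>2 / 2) * indicator {a..<b} y + (ennreal (w n a ((a + b) / 2) y) + ennreal (w n ((a + b) / 2) b y)) \<partial>\<mu>)"
  proof (intro nn_integral_cong)
    show "ennreal (w (Suc n) a b y) = ennreal ((alpha_inf a b)\<^sup>2 / 2) * indicator {a..<b} y + (ennreal (w n a ((a + b) / 2) y) + ennreal (w n ((a + b) / 2) b y))" for y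
      by (cases "y \<in> {a..<b}") (simp_all add: w_nonneg)
  qed
  also have "\<dots> = ennreal ((alpha_inf a b)\<^sup>2 / 2) * emeasure \<mu> {a..<b} + (ennreal (?T a ((a + b) / 2) / 2) + ennreal (?T ((a + b) / 2) b / 2))"
    using Suc.prems by (simp add: nn_integral_add nn_integral_cmult_indicator Suc.IH)
  also have "\<dots> = ennreal ((alpha_inf a b)\<^sup>2 / 2 * u a b + (?T a ((a + b) / 2) / 2 + ?T ((a + b) / 2) b / 2))"
    using Suc.prems T[of a "(a + b) / 2"] T[of "(a + b) / 2" b]
    by (simp add: X.emeasure_eq ennreal_mult'[symmetric] ennreal_plus[symmetric] del: ennreal_plus)
  also have "(alpha_inf a b)\<^sup>2 / 2 * u a b + (?T a ((a + b) / 2) / 2 + ?T ((a + b) / 2) b / 2) =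
      tree_total (Suc n) (\<lambda>a b. (alpha_inf a b)\<^sup>2 * u a b) a b / 2"
    unfolding tree_total_Suc by (simp only: add_divide_distrib times_divide_eq_left add.assoc)
  finally show ?case .
qed simp

text \<open>A Borel minorant g of the integrand in t is built along the branch of intervals
  containing y. An interval of length h uses only radii in [4h, 8h) and its descendants only radii
  below 4h, so contributions of different generations add without overlap.\<close>

lemma w_le_alpha_integral:
  assumes "a < b" "y \<in> {a..<b}"
  shows "\<exists>g \<in> borel_measurable borel.
    (\<forall>t. 0 \<le> g t \<and> ennreal (g t) \<le> ennreal ((alpha \<mu> \<nu> (ball y t))\<^sup>2 / t) * indicator {0<..<8 * (b - a)} t) \<and>
    ennreal (w n a b y) \<le> (\<integral>\<^sup>+ t. ennreal (g t) \<partial>lborel)"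
  using assms
proof (induction n arbitrary: a b)
  case 0
  show ?case by (rule bexI[of _ "\<lambda>_. 0"]) auto
next
  case (Suc n)
  define m h where "m = (a + b) / 2" and "h = b - a"
  have h: "h > 0" using Suc.prems by (simp add: h_def)
  \<comment> \<open>Only the half containing y contributes; \<open>w\<close> vanishes for the other
    one.\<close>
  obtain g where g: "g \<in> borel_measurable borel"
    "\<And>t. 0 \<le> g t" "\<And>t. ennreal (g t) \<le> ennreal ((alpha \<mu> \<nu> (ball y t))\<^sup>2 / t) * indicator {0<..<4 * h} t"
    "ennreal (w n a m y + w n m b y) \<le> (\<integral>\<^sup>+ t. ennreal (g t) \<partial>lborel)"
  proof (cases "y < m")
    case True
    then have "w n m b y = 0" using Suc.prems by (intro w_outside) (auto simp: m_def)
    moreover have "8 * (m - a) = 4 * h" by (simp add: m_def h_def field_simps)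
    ultimately show ?thesis
      using Suc.IH[of a m] True Suc.prems that by (auto simp: m_def)
  next
    case False
    then have "w n a m y = 0" using Suc.prems by (intro w_outside) (auto simp: m_def)
    moreover have "8 * (b - m) = 4 * h" by (simp add: m_def h_def field_simps)
    ultimately show ?thesis
      using Suc.IH[of m b] False Suc.prems that by (auto simp: m_def)
  qed
  \<comment> \<open>On [4h, 8h) one has 1/t >= 1/(8h), and this range has length 4h: hence the
    factor 1/2 in \<open>w\<close>.\<close>
  define c where "c = (alpha_inf a b)\<^sup>2 / (8 * h)"
  have c: "c \<ge> 0" using h by (simp add: c_def)
  define g' where "g' t = g t + c * indicator {4 * h..<8 * h} t" for t
  show ?case
  proof (intro bexI conjI allI)
    show "g' \<in> borel_measurable borel" unfolding g'_def using g(1) by simp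
    show "0 \<le> g' t" for t using g(2) c by (simp add: g'_def)
    show "ennreal (g' t) \<le> ennreal ((alpha \<mu> \<nu> (ball y t))\<^sup>2 / t) * indicator {0<..<8 * (b - a)} t" for t
    proof (cases "t \<in> {4 * h..<8 * h}")
      case True
      have "g t = 0" using g(3)[of t] g(2)[of t] True by (simp add: ennreal_eq_0_iff)
      have "alpha_inf a b \<le> alpha \<mu> \<nu> (ball y t)"
        using True Suc.prems by (intro alpha_inf_le) (auto simp: h_def)
      then have "(alpha_inf a b)\<^sup>2 \<le> (alpha \<mu> \<nu> (ball y t))\<^sup>2"
        using alpha_inf_nonneg Suc.prems by (intro power_mono) auto
      then have "c \<le> (alpha \<mu> \<nu> (ball y t))\<^sup>2 / t"
        unfolding c_def using True h by (intro frac_le) auto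
      then show ?thesis
        using True h \<open>g t = 0\<close> by (auto simp: g'_def h_def intro: ennreal_leI)
    next
      case False
      then have "g' t = g t" by (simp add: g'_def)
      moreover have "indicator {0<..<4 * h} t \<le> (indicator {0<..<8 * (b - a)} t :: ennreal)"
        using h by (auto simp: indicator_def h_def)
      then have "ennreal ((alpha \<mu> \<nu> (ball y t))\<^sup>2 / t) * indicator {0<..<4 * h} t
          \<le> ennreal ((alpha \<mu> \<nu> (ball y t))\<^sup>2 / t) * indicator {0<..<8 * (b - a)} t"
        by (rule mult_left_mono) simp
      ultimately show ?thesis
        using order_trans[OF g(3)[of t]] by simp
    qed
    have "ennreal (w (Suc n) a b y) = ennreal ((alpha_inf a b)\<^sup>2 / 2) + ennreal (w n a m y + w n m b y)"
      using Suc.prems by (simp add: m_def w_nonneg ennreal_plus[symmetric] del: ennreal_plus)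
    also have "ennreal ((alpha_inf a b)\<^sup>2 / 2) = ennreal c * emeasure lborel {4 * h..<8 * h}"
      using h c by (simp add: ennreal_mult[symmetric] c_def)
    also have "ennreal c * emeasure lborel {4 * h..<8 * h} + ennreal (w n a m y + w n m b y)
       \<le> (\<integral>\<^sup>+ t. ennreal c * indicator {4 * h..<8 * h} t \<partial>lborel) + (\<integral>\<^sup>+ t. ennreal (g t) \<partial>lborel)"
      using g(4) by (intro add_mono) (simp_all add: nn_integral_cmult_indicator)
    also have "\<dots> = (\<integral>\<^sup>+ t. ennreal c * indicator {4 * h..<8 * h} t + ennreal (g t) \<partial>lborel)"
      using g(1) by (intro nn_integral_add[symmetric]) auto
    also have "\<dots> = (\<integral>\<^sup>+ t. ennreal (g' t) \<partial>lborel)"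
    proof (intro nn_integral_cong)
      show "ennreal c * indicator {4 * h..<8 * h} t + ennreal (g t) = ennreal (g' t)" for t
        using g(2)[of t] c by (cases "t \<in> {4 * h..<8 * h}") (simp_all add: g'_def add.commute)
    qed
    finally show "ennreal (w (Suc n) a b y) \<le> (\<integral>\<^sup>+ t. ennreal (g' t) \<partial>lborel)" .
  qed
qed

text \<open>The hypothesis at the midpoint with r = 4h: the upper limit 2r = 8h of the radii is the
  top of the range used by the root, and three doublings lead back from radius 4h to h/2.\<close>

lemma alpha_inf_carleson:
  assumes ab: "a < b"
  shows "tree_total n (\<lambda>a b. (alpha_inf a b)\<^sup>2 * u a b) a b \<le> 2 * (C * D ^ 3) * u a b"
proof -
  define m h where "m = (a + b) / 2" and "h = b - a"
  have h: "h > 0" using ab by (simp add: h_def)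
  let ?I = "\<lambda>y. \<integral>\<^sup>+ t\<in>{0<..<2 * (4 * h)}. ennreal ((alpha \<mu> \<nu> (ball y t))\<^sup>2 / t) \<partial>lborel"
  have "ennreal (tree_total n (\<lambda>a b. (alpha_inf a b)\<^sup>2 * u a b) a b / 2) = (\<integral>\<^sup>+ y. ennreal (w n a b y) \<partial>\<mu>)"
    by (rule nn_integral_w[OF ab, symmetric])
  also have "\<dots> \<le> (\<integral>\<^sup>+ y\<in>ball m (2 * (4 * h)). ?I y \<partial>\<mu>)"
  proof (rule nn_integral_mono)
    fix y
    show "ennreal (w n a b y) \<le> ?I y * indicator (ball m (2 * (4 * h))) y"
    proof (cases "y \<in> {a..<b}")
      case True
      then have "y \<in> ball m (2 * (4 * h))"
        by (auto simp: m_def h_def ball_eq_greaterThanLessThan field_simps)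
      moreover obtain g where g: "\<And>t. ennreal (g t) \<le> ennreal ((alpha \<mu> \<nu> (ball y t))\<^sup>2 / t) * indicator {0<..<8 * (b - a)} t"
        "ennreal (w n a b y) \<le> (\<integral>\<^sup>+ t. ennreal (g t) \<partial>lborel)"
        using w_le_alpha_integral[OF ab True, of n] by blast
      moreover have "(\<integral>\<^sup>+ t. ennreal (g t) \<partial>lborel) \<le> ?I y"
        using g(1) by (intro nn_integral_mono) (simp add: h_def)
      ultimately show ?thesis by simp
    qed (simp add: w_outside[OF ab])
  qed
  also have "\<dots> \<le> ennreal C * emeasure \<mu> (ball m (4 * h))"
    using h by (intro carleson) auto
  also have "\<dots> \<le> ennreal C * ennreal (D ^ 3 * u a b)"
  proof (intro mult_left_mono)
    have "measure \<mu> (ball m (4 * h)) \<le> D ^ 3 * measure \<mu> (ball m (h / 2))"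
      using h by (intro X.measure_le_ball) auto
    also have "\<dots> \<le> D ^ 3 * u a b"
      using X.D_ge_1 by (intro mult_left_mono X.measure_mono_bounded)
        (auto simp: ball_eq_greaterThanLessThan m_def h_def field_simps)
    finally show "emeasure \<mu> (ball m (4 * h)) \<le> ennreal (D ^ 3 * u a b)"
      by (simp add: X.emeasure_eq ennreal_leI)
  qed auto
  also have "\<dots> = ennreal (C * D ^ 3 * u a b)"
    using C_ge_1 by (simp add: ennreal_mult'[symmetric] mult.assoc)
  finally have "tree_total n (\<lambda>a b. (alpha_inf a b)\<^sup>2 * u a b) a b / 2 \<le> C * D ^ 3 * u a b"
    using C_ge_1 X.D_ge_1 by (simp add: ennreal_le_iff)
  then show ?thesis by simp
qed

text \<open>The endpoint errors of generation k are at most alpha terms plus \<theta> < 1 times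
  those of generation k + 1. In the sum T over the first n generations the multiple \<theta> T is
  moved to the left, and the finest generation is bounded by mass, so B does not depend on
  n.\<close>

lemma Delta_carleson:
  obtains B where "B \<ge> 0" "\<And>n a b. a < b \<Longrightarrow> tree_total n (\<lambda>a b. (Delta a b)\<^sup>2 * u a b) a b \<le> B * u a b"
proof -
  obtain K where K: "K \<ge> 0" "\<And>a b. a < b \<Longrightarrow> (Delta a b)\<^sup>2 * u a b \<le>
    K * ((alpha_inf a b)\<^sup>2 * u a b + (E a ((b - a) / 2) + 2 * E ((a + b) / 2) ((b - a) / 2) + E b ((b - a) / 2)))"
    using Delta_E by blast
  define K1 where "K1 = (1 + 1 / c0) * (512 * D ^ 5)\<^sup>2 * D\<^sup>2"
  have K1: "K1 \<ge> 0" using c0 by (simp add: K1_def)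
  define \<theta> where "\<theta> = 1 - c0\<^sup>2"
  have \<theta>: "0 \<le> \<theta>" "\<theta> < 1" using c0 by (auto simp: \<theta>_def)
  define \<phi> where "\<phi> a b = (alpha_inf a b)\<^sup>2 * u a b" for a b
  define \<epsilon> where "\<epsilon> a b = E a (b - a) + E b (b - a)" for a b
  have half: "(a + b) / 2 - a = (b - a) / 2" "b - (a + b) / 2 = (b - a) / 2" for a b :: real
    by (auto simp: field_simps)
  have S_Suc: "tree_sum (Suc k) \<epsilon> a b =
      tree_sum k (\<lambda>a b. E a ((b - a) / 2) + 2 * E ((a + b) / 2) ((b - a) / 2) + E b ((b - a) / 2)) a b" for k a b
    unfolding tree_sum_Suc' \<epsilon>_def half by (simp add: algebra_simps)
  have \<epsilon>_step: "\<epsilon> a b \<le> 2 * K1 * \<phi> a b +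
      \<theta> * (E a ((b - a) / 2) + 2 * E ((a + b) / 2) ((b - a) / 2) + E b ((b - a) / 2))" if "a < b" for a b
  proof -
    have "E p (b - a) \<le> K1 * \<phi> a b + \<theta> * E p ((b - a) / 2)" if "p \<in> {a, b}" for p
      using E_step[OF \<open>a < b\<close> that] by (simp add: K1_def \<theta>_def \<phi>_def)
    from this[of a] this[of b]
    have "\<epsilon> a b \<le> 2 * K1 * \<phi> a b + \<theta> * (E a ((b - a) / 2) + E b ((b - a) / 2))"
      by (simp add: \<epsilon>_def algebra_simps)
    \<comment> \<open>The nonnegative midpoint errors are added to complete the next
      generation.\<close>
    also have "\<theta> * (E a ((b - a) / 2) + E b ((b - a) / 2)) \<le>
      \<theta> * (E a ((b - a) / 2) + 2 * E ((a + b) / 2) ((b - a) / 2) + E b ((b - a) / 2))"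
      using \<theta> E_nonneg[of "(b - a) / 2" "(a + b) / 2"] that by (intro mult_left_mono) auto
    finally show ?thesis by simp
  qed
  have S_step: "tree_sum k \<epsilon> a b \<le> 2 * K1 * tree_sum k \<phi> a b + \<theta> * tree_sum (Suc k) \<epsilon> a b" if "a < b" for k a b
    using tree_sum_mono[OF \<epsilon>_step that, where n=k] unfolding tree_sum_add tree_sum_cmult S_Suc by simp
  have \<epsilon>_nonneg: "0 \<le> \<epsilon> a b" if "a < b" for a b
    using that by (auto simp: \<epsilon>_def intro!: add_nonneg_nonneg E_nonneg)
  have S_le: "tree_sum k \<epsilon> a b \<le> 2 * D\<^sup>2 * u a b" if "a < b" for k a b
  proof -
    have "\<epsilon> a b \<le> 2 * D\<^sup>2 * u a b" if "a < b" for a b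
      using E_le_mt[of "b - a" a] E_le_mt[of "b - a" b] tent_int_le_u[of a b a] tent_int_le_u[of a b b] that
      by (simp add: \<epsilon>_def)
    from tree_sum_mono[of \<epsilon> "\<lambda>a b. 2 * D\<^sup>2 * u a b" a b k, OF this that] show ?thesis
      using tree_sum_cmult[of k "2 * D\<^sup>2" "\<lambda>a b. u a b" a b] X.tree_sum_measure[OF that, of k] by simp
  qed
  define B1 where "B1 = 2 * (C * D ^ 3)"
  define B where "B = K * (B1 + ((2 * K1 * B1 + 2 * D\<^sup>2) / (1 - \<theta>) + 2 * D\<^sup>2))"
  have B1: "B1 \<ge> 0" using C_ge_1 X.D_ge_1 by (simp add: B1_def)
  have main: "tree_total n (\<lambda>a b. (Delta a b)\<^sup>2 * u a b) a b \<le> B * u a b" if ab: "a < b" for n a b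
  proof -
    define T where "T = (\<Sum>k<n. tree_sum k \<epsilon> a b)"
    have W: "tree_total n \<phi> a b \<le> B1 * u a b"
      using alpha_inf_carleson[OF ab, of n] by (simp add: \<phi>_def[abs_def] B1_def)
    \<comment> \<open>Shifting the generation index adds only the finest generation, where
      \<open>S_le\<close> applies.\<close>
    have "(\<Sum>k<n. tree_sum (Suc k) \<epsilon> a b) = (\<Sum>k<Suc n. tree_sum k \<epsilon> a b) - tree_sum 0 \<epsilon> a b"
      by (subst sum.lessThan_Suc_shift) simp
    also have "\<dots> \<le> T + tree_sum n \<epsilon> a b"
      using \<epsilon>_nonneg[OF ab] by (simp add: T_def)
    also have "\<dots> \<le> T + 2 * D\<^sup>2 * u a b" using S_le[OF ab] by simp
    finally have shift: "(\<Sum>k<n. tree_sum (Suc k) \<epsilon> a b) \<le> T + 2 * D\<^sup>2 * u a b" .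
    have "T \<le> (\<Sum>k<n. 2 * K1 * tree_sum k \<phi> a b + \<theta> * tree_sum (Suc k) \<epsilon> a b)"
      unfolding T_def by (intro sum_mono S_step ab)
    also have "\<dots> = 2 * K1 * tree_total n \<phi> a b + \<theta> * (\<Sum>k<n. tree_sum (Suc k) \<epsilon> a b)"
      by (simp add: sum.distrib sum_distrib_left tree_total_def del: tree_sum.simps)
    also have "\<dots> \<le> 2 * K1 * (B1 * u a b) + \<theta> * (T + 2 * D\<^sup>2 * u a b)"
      using K1 \<theta> W shift by (intro add_mono mult_left_mono) auto
    also have "\<dots> \<le> 2 * K1 * (B1 * u a b) + (\<theta> * T + 2 * D\<^sup>2 * u a b)"
      using \<theta> by (simp add: distrib_left mult_left_le_one_le)
    finally have "(1 - \<theta>) * T \<le> (2 * K1 * B1 + 2 * D\<^sup>2) * u a b"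
      by (simp add: algebra_simps)
    then have T: "T \<le> (2 * K1 * B1 + 2 * D\<^sup>2) / (1 - \<theta>) * u a b"
      using \<theta> by (simp add: field_simps)
    have "tree_total n (\<lambda>a b. (Delta a b)\<^sup>2 * u a b) a b \<le> (\<Sum>k<n. K * (tree_sum k \<phi> a b + tree_sum (Suc k) \<epsilon> a b))"
      unfolding tree_total_def
    proof (rule sum_mono)
      fix k
      show "tree_sum k (\<lambda>a b. (Delta a b)\<^sup>2 * u a b) a b \<le> K * (tree_sum k \<phi> a b + tree_sum (Suc k) \<epsilon> a b)"
        using tree_sum_mono[OF K(2) ab, where n=k] unfolding tree_sum_add tree_sum_cmult S_Suc \<phi>_def by simp
    qed
    also have "\<dots> = K * (tree_total n \<phi> a b + (\<Sum>k<n. tree_sum (Suc k) \<epsilon> a b))"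
      by (simp add: sum.distrib sum_distrib_left[symmetric] tree_total_def del: tree_sum.simps)
    also have "\<dots> \<le> K * (B1 * u a b + ((2 * K1 * B1 + 2 * D\<^sup>2) / (1 - \<theta>) * u a b + 2 * D\<^sup>2 * u a b))"
      using W shift T by (intro mult_left_mono K) linarith
    also have "\<dots> = B * u a b" by (simp add: B_def algebra_simps)
    finally show ?thesis .
  qed
  have "B \<ge> 0" unfolding B_def using K(1) B1 K1 \<theta> by auto
  then show ?thesis using main that by blast
qed

end

section \<open>Relative entropy and small dyadic sets\<close>

text \<open>Only the trace of A on [a,b) is constrained, so the same A can be handed to both
  halves.\<close>

primrec dyadic :: "nat \<Rightarrow> real \<Rightarrow> real \<Rightarrow> real set \<Rightarrow> bool" where
  "dyadic 0 a b A \<longleftrightarrow> A \<inter> {a..<b} = {} \<or> {a..<b} \<subseteq> A"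
| "dyadic (Suc n) a b A \<longleftrightarrow> dyadic n a ((a + b) / 2) A \<and> dyadic n ((a + b) / 2) b A"

lemma bounded_Ico: "bounded {a..<b::real}"
  by (rule bounded_subset[OF bounded_closed_interval[of a b]]) auto

lemma Ico_halves:
  fixes a b :: real
  assumes "a < b" shows "{a..<b} = {a..<(a + b) / 2} \<union> {(a + b) / 2..<b}"
  using assms by auto

lemma dyadic_cong:
  "a < b \<Longrightarrow> A \<inter> {a..<b} = A' \<inter> {a..<b} \<Longrightarrow> dyadic n a b A \<longleftrightarrow> dyadic n a b A'"
proof (induction n arbitrary: a b)
  case 0
  then show ?case by auto
next
  case (Suc n)
  have "A \<inter> {a..<(a + b) / 2} = A' \<inter> {a..<(a + b) / 2}" "A \<inter> {(a + b) / 2..<b} = A' \<inter> {(a + b) / 2..<b}"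
    using Suc.prems Ico_halves[OF Suc.prems(1)] by blast+
  then show ?case using Suc by simp
qed

lemma dyadic_full: "a < b \<Longrightarrow> {a..<b} \<subseteq> A \<Longrightarrow> dyadic n a b A"
proof (induction n arbitrary: a b)
  case (Suc n)
  then show ?case using Ico_halves[OF Suc.prems(1)] by (auto simp del: atLeastLessThan_iff)
qed simp

lemma dyadic_borel: "a < b \<Longrightarrow> dyadic n a b A \<Longrightarrow> A \<inter> {a..<b} \<in> sets borel"
proof (induction n arbitrary: a b)
  case 0
  then consider "A \<inter> {a..<b} = {}" | "A \<inter> {a..<b} = {a..<b}" by auto
  then show ?case by cases simp_all
next
  case (Suc n)
  have "A \<inter> {a..<b} = (A \<inter> {a..<(a + b) / 2}) \<union> (A \<inter> {(a + b) / 2..<b})"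
    using Ico_halves[OF Suc.prems(1)] by blast
  then show ?case using Suc by simp
qed

text \<open>These sets exhaust an open V inside [a,b) from within, which transfers estimates for
  dyadic sets to open sets.\<close>

primrec dyadic_inner :: "nat \<Rightarrow> real \<Rightarrow> real \<Rightarrow> real set \<Rightarrow> real set" where
  "dyadic_inner 0 a b V = (if {a..<b} \<subseteq> V then {a..<b} else {})"
| "dyadic_inner (Suc n) a b V = dyadic_inner n a ((a + b) / 2) V \<union> dyadic_inner n ((a + b) / 2) b V"

lemma dyadic_inner_subset: "a < b \<Longrightarrow> dyadic_inner n a b V \<subseteq> V \<inter> {a..<b}"
proof (induction n arbitrary: a b)
  case (Suc n)
  have m: "a < (a + b) / 2" "(a + b) / 2 < b" using Suc.prems by auto
  show ?case
    using Ico_halves[OF Suc.prems] Suc.IH[OF m(1)] Suc.IH[OF m(2)] unfolding dyadic_inner.simps by blast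
qed auto

lemma dyadic_dyadic_inner: "a < b \<Longrightarrow> dyadic n a b (dyadic_inner n a b V)"
proof (induction n arbitrary: a b)
  case (Suc n)
  let ?m = "(a + b) / 2"
  have m: "a < ?m" "?m < b" using Suc.prems by auto
  note sub = dyadic_inner_subset[OF m(1), of n V] dyadic_inner_subset[OF m(2), of n V]
  have "{a..<?m} \<inter> {?m..<b} = {}" by auto
  then have "dyadic_inner (Suc n) a b V \<inter> {a..<?m} = dyadic_inner n a ?m V \<inter> {a..<?m}"
    "dyadic_inner (Suc n) a b V \<inter> {?m..<b} = dyadic_inner n ?m b V \<inter> {?m..<b}"
    using sub by auto
  then show ?case
    using Suc.IH[OF m(1)] Suc.IH[OF m(2)] dyadic_cong[OF m(1)] dyadic_cong[OF m(2)]
    by (metis dyadic.simps(2))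
qed simp

lemma dyadic_inner_full: "a < b \<Longrightarrow> {a..<b} \<subseteq> V \<Longrightarrow> dyadic_inner n a b V = {a..<b}"
proof (induction n arbitrary: a b)
  case (Suc n)
  then show ?case using Ico_halves[OF Suc.prems(1)] by simp
qed simp

lemma dyadic_inner_mono: "a < b \<Longrightarrow> dyadic_inner n a b V \<subseteq> dyadic_inner (Suc n) a b V"
proof (induction n arbitrary: a b)
  case 0
  then show ?case using dyadic_inner_full[OF 0, of V 1] by auto
next
  case (Suc n)
  then show ?case
    using Suc.IH[of a "(a + b) / 2"] Suc.IH[of "(a + b) / 2" b]
    unfolding dyadic_inner.simps(2)[of "Suc n"] dyadic_inner.simps(2)[of n a b] by (intro Un_mono) auto
qed

lemma dyadic_inner_mem:
  assumes "ball x \<epsilon> \<subseteq> V" "a < b" "x \<in> {a..<b}" "b - a < 2 ^ n * \<epsilon>"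
  shows "x \<in> dyadic_inner n a b V"
  using assms(2-)
proof (induction n arbitrary: a b)
  case 0
  then have "{a..<b} \<subseteq> ball x \<epsilon>" by (auto simp: dist_real_def)
  then show ?case using assms(1) 0 by simp
next
  case (Suc n)
  have "(a + b) / 2 - a < 2 ^ n * \<epsilon>" "b - (a + b) / 2 < 2 ^ n * \<epsilon>" using Suc.prems by (auto simp: field_simps)
  then show ?case using Suc.IH[of a "(a + b) / 2"] Suc.IH[of "(a + b) / 2" b] Suc.prems
    by (cases "x < (a + b) / 2") auto
qed

lemma UN_dyadic_inner:
  assumes "open V" "a < b" shows "(\<Union>n. dyadic_inner n a b V) = V \<inter> {a..<b}"
proof (intro antisym subsetI)
  fix x assume x: "x \<in> V \<inter> {a..<b}"
  then obtain \<epsilon> where "\<epsilon> > 0" "ball x \<epsilon> \<subseteq> V" using assms(1) openE by blast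
  moreover obtain n where "(b - a) / \<epsilon> < 2 ^ n" using real_arch_pow[of 2] by auto
  ultimately have "x \<in> dyadic_inner n a b V"
    using x assms by (intro dyadic_inner_mem[of x \<epsilon>]) (auto simp: field_simps)
  then show "x \<in> (\<Union>n. dyadic_inner n a b V)" by blast
qed (use dyadic_inner_subset[OF assms(2)] in blast)

text \<open>Both logarithms are bounded by ln z <= z - 1; the right side is the chi-square distance
  of the two-point distributions.\<close>

lemma two_point_entropy:
  fixes p q :: real
  assumes p: "0 < p" "p < 1" and q: "0 < q" "q < 1"
  shows "p * ln (p / q) + (1 - p) * ln ((1 - p) / (1 - q)) \<le> (p - q)\<^sup>2 / (q * (1 - q))"
proof -
  have "p * ln (p / q) + (1 - p) * ln ((1 - p) / (1 - q)) \<le> p * (p / q - 1) + (1 - p) * ((1 - p) / (1 - q) - 1)"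
    using p q by (intro add_mono mult_left_mono ln_le_minus_one) auto
  also have "\<dots> = (p - q)\<^sup>2 / (q * (1 - q))"
    using q by (simp add: field_simps power2_eq_square)
  finally show ?thesis .
qed

context doubling
begin

text \<open>A ball whose radius is a quarter of the length fills either half up to endpoints, and
  its fourfold dilate covers the whole interval.\<close>

lemma measure_Ico_child:
  assumes "a < b"
  shows "measure M {a..<b} \<le> D\<^sup>2 * measure M {a..<(a + b) / 2}"
    and "measure M {a..<b} \<le> D\<^sup>2 * measure M {(a + b) / 2..<b}"
proof -
  have *: "measure M {a..<b} \<le> D\<^sup>2 * measure M {c - r..<c + r}"
    if "r > 0" "{a..<b} \<subseteq> ball c (2\<^sup>2 * r)" for c r
  proof -
    have "measure M {a..<b} \<le> D\<^sup>2 * measure M (ball c r)"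
      using that by (intro measure_le_ball) auto
    also have "\<dots> \<le> D\<^sup>2 * measure M {c - r..<c + r}"
      using that by (intro mult_left_mono measure_mono_bounded) (auto simp: ball_eq_greaterThanLessThan)
    finally show ?thesis .
  qed
  define r where "r = (b - a) / 4"
  have r: "r > 0" "b = a + 4 * r" using assms by (auto simp: r_def field_simps)
  have mid: "(a + b) / 2 = a + 2 * r" by (simp add: r(2) field_simps)
  have "{a..<b} \<subseteq> ball (a + r) (2\<^sup>2 * r)" "{a..<b} \<subseteq> ball (b - r) (2\<^sup>2 * r)"
    using r by (auto simp: ball_eq_greaterThanLessThan)
  note *[OF r(1) this(1)] *[OF r(1) this(2)]
  moreover have "{a + r - r..<a + r + r} = {a..<a + 2 * r}" "{b - r - r..<b - r + r} = {a + 2 * r..<b}"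
    by (simp_all add: r(2) add.commute)
  ultimately show "measure M {a..<b} \<le> D\<^sup>2 * measure M {a..<(a + b) / 2}"
    "measure M {a..<b} \<le> D\<^sup>2 * measure M {(a + b) / 2..<b}"
    unfolding mid by simp_all
qed

lemma measure_Int_Ico_split:
  assumes "a < b" "A \<inter> {a..<b} \<in> sets borel"
  shows "measure M (A \<inter> {a..<b}) = measure M (A \<inter> {a..<(a + b) / 2}) + measure M (A \<inter> {(a + b) / 2..<b})"
proof -
  have *: "A \<inter> {a..<(a + b) / 2} = (A \<inter> {a..<b}) \<inter> {a..<(a + b) / 2}"
    "A \<inter> {(a + b) / 2..<b} = (A \<inter> {a..<b}) \<inter> {(a + b) / 2..<b}"
    using assms(1) by auto
  have "A \<inter> {a..<(a + b) / 2} \<in> sets borel" "A \<inter> {(a + b) / 2..<b} \<in> sets borel"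
    unfolding * using assms(2) by auto
  moreover have "A \<inter> {a..<b} = (A \<inter> {a..<(a + b) / 2}) \<union> (A \<inter> {(a + b) / 2..<b})"
    using assms(1) by auto
  ultimately show ?thesis
    by (metis (no_types, lifting) measure_Un_disjoint bounded_Int bounded_Ico disjoint_iff
        Int_iff atLeastLessThan_iff not_le)
qed

end

section \<open>Relative entropy along the dyadic tree\<close>

context doubling_pair
begin

text \<open>Summed over a generation and divided by the mass of the root, this is the relative
  entropy of the normalised measures on that partition, up to the constant ln(u/v) of the
  root.\<close>

definition ent :: "real \<Rightarrow> real \<Rightarrow> real" where "ent a b = u a b * ln (u a b / v a b)"

lemma u_pos: "a < b \<Longrightarrow> u a b > 0" and v_pos: "a < b \<Longrightarrow> v a b > 0"
  using X.measure_Ico_pos Y.measure_Ico_pos by auto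

text \<open>Chain rule: the increment is \<open>u a b\<close> times the relative entropy of (p, 1 -
  p) with respect to (q, 1 - q). Doubling of \<nu> keeps q and 1 - q above D^-2, so the chi-square
  denominator costs at most D^4.\<close>

lemma ent_step:
  assumes ab: "a < b"
  shows "ent a ((a + b) / 2) + ent ((a + b) / 2) b \<le> ent a b + D ^ 4 * ((Delta a b)\<^sup>2 * u a b)"
proof -
  define m p q where "m = (a + b) / 2" and "p = u a m / u a b" and "q = v a m / v a b"
  have m: "a < m" "m < b" using ab by (auto simp: m_def)
  note pos = u_pos[OF ab] u_pos[OF m(1)] u_pos[OF m(2)] v_pos[OF ab] v_pos[OF m(1)] v_pos[OF m(2)]
  have us: "u a b = u a m + u m b" and vs: "v a b = v a m + v m b"
    using X.measure_Ico_split[of a m b] Y.measure_Ico_split[of a m b] m by auto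
  have 1: "1 - p = u m b / u a b" "1 - q = v m b / v a b"
    using us vs pos by (auto simp: p_def q_def field_simps)
  have p: "0 < p" "p < 1" and q: "0 < q" "q < 1"
    using us vs pos by (auto simp: p_def q_def)
  have "1 / D\<^sup>2 \<le> q" "1 / D\<^sup>2 \<le> v m b / v a b"
    using Y.measure_Ico_child[OF ab] pos Y.D_ge_1 unfolding q_def m_def[symmetric]
    by (auto simp: field_simps)
  then have "(1 / D\<^sup>2) * (1 / D\<^sup>2) \<le> q * (1 - q)"
    unfolding 1(2) using q by (intro mult_mono) auto
  then have "1 / D ^ 4 \<le> q * (1 - q)" by (simp add: power_add[symmetric])
  then have "1 / (q * (1 - q)) \<le> D ^ 4"
    using q Y.D_ge_1 by (simp add: field_simps)
  then have d: "(p - q)\<^sup>2 / (q * (1 - q)) \<le> (p - q)\<^sup>2 * D ^ 4"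
    using mult_left_mono[of "1 / (q * (1 - q))" "D ^ 4" "(p - q)\<^sup>2"] by simp
  have ln1: "ln (u a m / v a m) = ln (p / q) + ln (u a b / v a b)"
  proof -
    have "u a m / v a m = (p / q) * (u a b / v a b)" using pos by (simp add: p_def q_def)
    then show ?thesis using pos p q by (simp only:) (rule ln_mult_pos; simp)
  qed
  have ln2: "ln (u m b / v m b) = ln ((1 - p) / (1 - q)) + ln (u a b / v a b)"
  proof -
    have "u m b / v m b = ((1 - p) / (1 - q)) * (u a b / v a b)" unfolding 1 using pos by simp
    then show ?thesis using pos p q by (simp only:) (rule ln_mult_pos; simp)
  qed
  have up: "u a m = p * u a b" "u m b = (1 - p) * u a b"
    unfolding 1 using pos by (auto simp: p_def)
  have "ent a m + ent m b - ent a b = u a m * ln (u a m / v a m) + u m b * ln (u m b / v m b) - u a b * ln (u a b / v a b)"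
    by (simp add: ent_def)
  also have "\<dots> = u a m * ln (p / q) + u m b * ln ((1 - p) / (1 - q)) + (u a m + u m b - u a b) * ln (u a b / v a b)"
    unfolding ln1 ln2 by (simp add: algebra_simps)
  also have "\<dots> = u a b * (p * ln (p / q) + (1 - p) * ln ((1 - p) / (1 - q)))"
    using us by (simp only: up) (simp add: algebra_simps)
  also have "\<dots> \<le> u a b * ((p - q)\<^sup>2 * D ^ 4)"
    using order_trans[OF two_point_entropy[OF p q] d] pos by (intro mult_left_mono) auto
  also have "\<dots> = D ^ 4 * ((Delta a b)\<^sup>2 * u a b)"
    by (simp add: Delta_def p_def q_def m_def)
  finally show ?thesis by (simp add: m_def)
qed

lemma tree_sum_ent_le:
  "a < b \<Longrightarrow> tree_sum n ent a b \<le> ent a b + D ^ 4 * tree_total n (\<lambda>a b. (Delta a b)\<^sup>2 * u a b) a b"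
proof (induction n arbitrary: a b)
  case (Suc n)
  have m: "a < (a + b) / 2" "(a + b) / 2 < b" using Suc.prems by auto
  show ?case
    using ent_step[OF Suc.prems] Suc.IH[OF m(1)] Suc.IH[OF m(2)]
    unfolding tree_sum.simps tree_total_Suc distrib_left by linarith
qed simp

text \<open>A supporting-plane bound with a free slope s. It is linear in the two masses and
  therefore adds up over cells.\<close>

lemma ent_ge:
  assumes "a < b" "s > 0" shows "u a b * (1 + ln s) - s * v a b \<le> ent a b"
proof -
  note pos = u_pos[OF assms(1)] v_pos[OF assms(1)]
  have "ln (s * v a b / u a b) \<le> s * v a b / u a b - 1"
    using pos assms(2) by (intro ln_le_minus_one) auto
  moreover have "ln (s * v a b / u a b) = ln s - ln (u a b / v a b)"
    using pos assms(2) by (simp add: ln_div ln_mult)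
  ultimately have "1 + ln s - s * v a b / u a b \<le> ln (u a b / v a b)" by linarith
  from mult_left_mono[OF this, of "u a b"] show ?thesis
    using pos by (simp add: ent_def algebra_simps)
qed

text \<open>The dual formula for entropy, tested with a function taking two values: slope s on the
  cells in A, slope t on the others.\<close>

lemma tree_sum_ent_ge:
  assumes s: "s > 0" and t: "t > 0"
  shows "a < b \<Longrightarrow> dyadic n a b A \<Longrightarrow>
    measure \<mu> (A \<inter> {a..<b}) * (1 + ln s) - s * measure \<nu> (A \<inter> {a..<b}) +
    ((u a b - measure \<mu> (A \<inter> {a..<b})) * (1 + ln t) - t * (v a b - measure \<nu> (A \<inter> {a..<b})))
    \<le> tree_sum n ent a b"
proof (induction n arbitrary: a b)
  case 0
  then consider "A \<inter> {a..<b} = {}" | "A \<inter> {a..<b} = {a..<b}" by auto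
  then show ?case using ent_ge[OF 0(1) s] ent_ge[OF 0(1) t] by cases simp_all
next
  case (Suc n)
  define m where "m = (a + b) / 2"
  have m: "a < m" "m < b" using Suc.prems by (auto simp: m_def)
  have us: "u a b = u a m + u m b" and vs: "v a b = v a m + v m b"
    using X.measure_Ico_split[of a m b] Y.measure_Ico_split[of a m b] m by auto
  have As: "measure \<mu> (A \<inter> {a..<b}) = measure \<mu> (A \<inter> {a..<m}) + measure \<mu> (A \<inter> {m..<b})"
    "measure \<nu> (A \<inter> {a..<b}) = measure \<nu> (A \<inter> {a..<m}) + measure \<nu> (A \<inter> {m..<b})"
    using X.measure_Int_Ico_split[OF Suc.prems(1) dyadic_borel[OF Suc.prems]]
      Y.measure_Int_Ico_split[OF Suc.prems(1) dyadic_borel[OF Suc.prems]] by (auto simp: m_def)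
  have "dyadic n a m A" "dyadic n m b A" using Suc.prems by (auto simp: m_def)
  then show ?case
    using Suc.IH[OF m(1)] Suc.IH[OF m(2)] unfolding us vs As tree_sum.simps m_def[symmetric]
    by (simp add: algebra_simps)
qed

end

section \<open>From bounded entropy to a power estimate for Borel sets\<close>

context carleson_pair
begin

definition dyadic_small :: "real \<Rightarrow> bool" where
  "dyadic_small \<rho> \<longleftrightarrow> (\<forall>n a b A. a < b \<longrightarrow> dyadic n a b A \<longrightarrow>
    measure \<mu> (A \<inter> {a..<b}) \<le> u a b / 4 \<longrightarrow> measure \<nu> (A \<inter> {a..<b}) \<le> \<rho> * v a b)"

lemma dyadic_smallD:
  "dyadic_small \<rho> \<Longrightarrow> a < b \<Longrightarrow> dyadic n a b A \<Longrightarrow> measure \<mu> (A \<inter> {a..<b}) \<le> u a b / 4 \<Longrightarrow>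
    measure \<nu> (A \<inter> {a..<b}) \<le> \<rho> * v a b"
  unfolding dyadic_small_def by blast

text \<open>The slopes are z = u/v on A and z T off A. With x and y the \<mu>- and \<nu>-mass of the
  rest of [a,b), the entropy bound reduces to x l + z y <= z T y + D^4 B u. As x is at least 3u/4,
  the \<nu>-mass y cannot be below v/T.\<close>

lemma ex_dyadic_small:
  obtains \<rho> where "0 \<le> \<rho>" "\<rho> < 1" "dyadic_small \<rho>"
proof -
  obtain B where B: "B \<ge> 0" "\<And>n a b. a < b \<Longrightarrow> tree_total n (\<lambda>a b. (Delta a b)\<^sup>2 * u a b) a b \<le> B * u a b"
    using Delta_carleson by blast
  \<comment> \<open>Chosen so that 3/4 u l exceeds the entropy term D^4 B u by exactly u.\<close>
  define l where "l = 4 / 3 * (D ^ 4 * B + 1)"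
  define T where "T = exp l"
  have l: "l > 0" using B(1) X.D_ge_1 by (auto simp: l_def intro!: add_nonneg_pos)
  then have T: "T > 1" "ln T = l" by (auto simp: T_def)
  have "measure \<nu> (A \<inter> {a..<b}) \<le> (1 - 1 / T) * v a b"
    if ab: "a < b" and A: "dyadic n a b A" "measure \<mu> (A \<inter> {a..<b}) \<le> u a b / 4" for n a b A
  proof -
    note pos = u_pos[OF ab] v_pos[OF ab]
    define z x y where "z = u a b / v a b" and "x = u a b - measure \<mu> (A \<inter> {a..<b})"
      and "y = v a b - measure \<nu> (A \<inter> {a..<b})"
    have z: "z > 0" "z * v a b = u a b" using pos by (auto simp: z_def)
    have lnz: "ln (z * T) = ln z + l" using z T by (simp add: ln_mult)
    have "(u a b - x) * (1 + ln z) - z * (v a b - y) + (x * (1 + ln (z * T)) - (z * T) * y) \<le> tree_sum n ent a b"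
      using tree_sum_ent_ge[OF z(1) _ ab A(1), of "z * T"] z T by (simp add: x_def y_def)
    also have "\<dots> \<le> ent a b + D ^ 4 * (B * u a b)"
    proof -
      have "D ^ 4 * tree_total n (\<lambda>a b. (Delta a b)\<^sup>2 * u a b) a b \<le> D ^ 4 * (B * u a b)"
        using X.D_ge_1 by (intro mult_left_mono B(2) ab) auto
      then show ?thesis using tree_sum_ent_le[OF ab, of n] by linarith
    qed
    finally have "(u a b - x) * (1 + ln z) - z * (v a b - y) + (x * (1 + (ln z + l)) - (z * T) * y)
      \<le> u a b * ln z + D ^ 4 * (B * u a b)" unfolding lnz ent_def z_def[symmetric] .
    then have 1: "x * l + z * y \<le> z * T * y + D ^ 4 * B * u a b"
      using z(2) by (simp add: algebra_simps)
    have y: "y \<ge> 0"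
      unfolding y_def using dyadic_borel[OF ab A(1)] by (simp add: Y.measure_mono_bounded)
    have "3 / 4 * u a b * l \<le> x * l"
      using l A(2) by (intro mult_right_mono) (auto simp: x_def)
    moreover have "3 / 4 * u a b * l = D ^ 4 * B * u a b + u a b" by (simp add: l_def algebra_simps)
    moreover have "0 \<le> z * y" using y z by simp
    ultimately have "u a b \<le> z * T * y" using 1 by linarith
    then have "z * v a b \<le> z * (T * y)" using z by (simp add: mult.assoc)
    then have "v a b \<le> T * y" using z(1) by (rule mult_left_le_imp_le)
    then have "v a b / T \<le> y" using T by (simp add: field_simps)
    then show ?thesis by (simp add: y_def algebra_simps)
  qed
  moreover have "0 \<le> 1 - 1 / T" "1 - 1 / T < 1" using T by auto
  ultimately show ?thesis using that unfolding dyadic_small_def by blast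
qed

text \<open>A' is the union of the maximal dyadic intervals on which the \<mu>-density of A exceeds
  1/(4 D^2). The invariant that this density is at most 1/4 makes \<open>dyadic_small\<close>
  applicable on each of them, and in the base case it rules out a full cell.\<close>

lemma calderon_zygmund:
  assumes \<rho>: "0 \<le> \<rho>" "dyadic_small \<rho>"
  shows "a < b \<Longrightarrow> dyadic n a b A \<Longrightarrow> measure \<mu> (A \<inter> {a..<b}) \<le> u a b / 4 \<Longrightarrow>
    \<exists>A'. dyadic n a b A' \<and> A' \<subseteq> {a..<b} \<and> measure \<mu> A' \<le> 4 * D\<^sup>2 * measure \<mu> (A \<inter> {a..<b}) \<and>
      measure \<nu> (A \<inter> {a..<b}) \<le> \<rho> * measure \<nu> A'"
proof (induction n arbitrary: a b)
  case 0
  show ?case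
  proof (cases "A \<inter> {a..<b} = {}")
    case True
    then show ?thesis by (intro exI[of _ "{}"]) auto
  next
    case False
    then have "A \<inter> {a..<b} = {a..<b}" using 0 by auto
    then show ?thesis using 0(3) u_pos[OF 0(1)] by simp
  qed
next
  case (Suc n)
  note ab = Suc.prems(1) and A = Suc.prems(2,3)
  define m where "m = (a + b) / 2"
  have m: "a < m" "m < b" using ab by (auto simp: m_def)
  have D2: "D\<^sup>2 \<ge> 1" using X.D_ge_1 by simp
  show ?case
  \<comment> \<open>The stopping condition; when it holds, the whole interval is taken into
    A'.\<close>
  proof (cases "u a b < 4 * D\<^sup>2 * measure \<mu> (A \<inter> {a..<b})")
    case True
    then show ?thesis
      using dyadic_smallD[OF \<rho>(2) ab A] dyadic_full[OF ab, of "{a..<b}" "Suc n"] by (intro exI[of _ "{a..<b}"]) auto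
  next
    case False
    then have le: "D\<^sup>2 * measure \<mu> (A \<inter> {a..<b}) \<le> u a b / 4" by simp
    have An: "dyadic n a m A" "dyadic n m b A" using A by (auto simp: m_def)
    have As: "measure \<mu> (A \<inter> {a..<b}) = measure \<mu> (A \<inter> {a..<m}) + measure \<mu> (A \<inter> {m..<b})"
      "measure \<nu> (A \<inter> {a..<b}) = measure \<nu> (A \<inter> {a..<m}) + measure \<nu> (A \<inter> {m..<b})"
      using X.measure_Int_Ico_split[OF ab dyadic_borel[OF ab A(1)]]
        Y.measure_Int_Ico_split[OF ab dyadic_borel[OF ab A(1)]] by (auto simp: m_def)
    \<comment> \<open>Before stopping the density is at most 1/(4 D^2), and a child holds at least
      the share 1/D^2 of the mass, so the density in it is still at most 1/4.\<close>
    have child: "measure \<mu> (A \<inter> J) \<le> w' / 4"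
      if "measure \<mu> (A \<inter> J) \<le> measure \<mu> (A \<inter> {a..<b})" "u a b \<le> D\<^sup>2 * w'" for J w'
    proof -
      have "D\<^sup>2 * measure \<mu> (A \<inter> J) \<le> D\<^sup>2 * measure \<mu> (A \<inter> {a..<b})"
        using that by (intro mult_left_mono) auto
      also have "\<dots> \<le> D\<^sup>2 * w' / 4" using le that by simp
      finally have "D\<^sup>2 * measure \<mu> (A \<inter> J) \<le> D\<^sup>2 * (w' / 4)" by simp
      then show ?thesis by (rule mult_left_le_imp_le) (use D2 in linarith)
    qed
    obtain A1 where A1: "dyadic n a m A1" "A1 \<subseteq> {a..<m}" "measure \<mu> A1 \<le> 4 * D\<^sup>2 * measure \<mu> (A \<inter> {a..<m})"
      "measure \<nu> (A \<inter> {a..<m}) \<le> \<rho> * measure \<nu> A1"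
      using Suc.IH[OF m(1) An(1) child] As X.measure_Ico_child(1)[OF ab] unfolding m_def by auto
    obtain A2 where A2: "dyadic n m b A2" "A2 \<subseteq> {m..<b}" "measure \<mu> A2 \<le> 4 * D\<^sup>2 * measure \<mu> (A \<inter> {m..<b})"
      "measure \<nu> (A \<inter> {m..<b}) \<le> \<rho> * measure \<nu> A2"
      using Suc.IH[OF m(2) An(2) child] As X.measure_Ico_child(2)[OF ab] unfolding m_def by auto
    have disj: "{a..<m} \<inter> {m..<b} = {}" by auto
    have "(A1 \<union> A2) \<inter> {a..<m} = A1 \<inter> {a..<m}" "(A1 \<union> A2) \<inter> {m..<b} = A2 \<inter> {m..<b}"
      using A1(2) A2(2) disj by blast+
    then have "dyadic (Suc n) a b (A1 \<union> A2)"
      using A1(1) A2(1) dyadic_cong[OF m(1)] dyadic_cong[OF m(2)] by (metis dyadic.simps(2) m_def)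
    moreover have "A1 \<union> A2 \<subseteq> {a..<b}" using A1(2) A2(2) m by fastforce
    moreover have "A1 \<in> sets borel" "A2 \<in> sets borel"
      using dyadic_borel[OF m(1) A1(1)] dyadic_borel[OF m(2) A2(1)] A1(2) A2(2) by (simp_all add: Int_absorb2)
    then have "measure \<mu> (A1 \<union> A2) = measure \<mu> A1 + measure \<mu> A2" "measure \<nu> (A1 \<union> A2) = measure \<nu> A1 + measure \<nu> A2"
      using A1(2) A2(2) disj
      by (blast intro!: X.measure_Un_disjoint Y.measure_Un_disjoint bounded_subset[OF bounded_Ico])+
    ultimately show ?thesis
      using A1(3,4) A2(3,4) As by (intro exI[of _ "A1 \<union> A2"]) (simp add: distrib_left)
  qed
qed

text \<open>Passing from A to its Calderon-Zygmund set costs a factor 4 D^2 in \<mu> and gains a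
  factor \<rho> in \<nu>; each step uses up one power of 1/(4 D^2).\<close>

lemma dyadic_power_small:
  assumes \<rho>: "0 \<le> \<rho>" "dyadic_small \<rho>"
    and ab: "a < b"
  shows "dyadic n a b A \<Longrightarrow> measure \<mu> (A \<inter> {a..<b}) \<le> (1 / (4 * D\<^sup>2)) ^ k * u a b \<Longrightarrow>
    measure \<nu> (A \<inter> {a..<b}) \<le> \<rho> ^ k * v a b"
proof (induction k arbitrary: A)
  case 0
  then show ?case using dyadic_borel[OF ab 0(1)] by (simp add: Y.measure_mono_bounded)
next
  case (Suc k)
  have D2: "D\<^sup>2 \<ge> 1" using X.D_ge_1 by simp
  have "(1 / (4 * D\<^sup>2)) ^ Suc k \<le> 1 / 4"
  proof -
    have "1 / (4 * D\<^sup>2) \<le> 1 / 4" using D2 by (intro divide_left_mono) auto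
    moreover from this have "(1 / (4 * D\<^sup>2)) ^ k \<le> 1" by (intro power_le_one) auto
    ultimately have "1 / (4 * D\<^sup>2) * (1 / (4 * D\<^sup>2)) ^ k \<le> 1 / 4 * 1" using D2 by (intro mult_mono) auto
    then show ?thesis by simp
  qed
  then have "(1 / (4 * D\<^sup>2)) ^ Suc k * u a b \<le> 1 / 4 * u a b" by (intro mult_right_mono) auto
  then have "measure \<mu> (A \<inter> {a..<b}) \<le> u a b / 4" using Suc.prems by simp
  then obtain A' where A': "dyadic n a b A'" "A' \<subseteq> {a..<b}" "measure \<mu> A' \<le> 4 * D\<^sup>2 * measure \<mu> (A \<inter> {a..<b})"
      "measure \<nu> (A \<inter> {a..<b}) \<le> \<rho> * measure \<nu> A'"
    using calderon_zygmund[OF \<rho> ab Suc.prems(1)] by blast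
  have "measure \<mu> A' \<le> 4 * D\<^sup>2 * ((1 / (4 * D\<^sup>2)) ^ Suc k * u a b)"
    using A'(3) Suc.prems(2) D2 by (elim order_trans) (intro mult_left_mono, auto)
  also have "\<dots> = (1 / (4 * D\<^sup>2)) ^ k * u a b" using X.D_ge_1 by simp
  finally have "measure \<nu> A' \<le> \<rho> ^ k * v a b"
    using Suc.IH[OF A'(1)] A'(2) by (simp add: Int_absorb2)
  then have "\<rho> * measure \<nu> A' \<le> \<rho> * (\<rho> ^ k * v a b)" using \<rho>(1) by (intro mult_left_mono)
  then show ?case using A'(4) by (simp add: mult.assoc)
qed

text \<open>The strict inequality leaves room for an open V around A of still small \<mu>-mass in
  [a,b), whose dyadic inner parts satisfy the estimate at every generation.\<close>

lemma borel_power_small: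
  obtains \<eta> \<rho> where "0 < \<eta>" "0 \<le> \<rho>" "\<rho> < 1"
    "\<And>a b A k. a < b \<Longrightarrow> A \<in> sets borel \<Longrightarrow> A \<subseteq> {a..<b} \<Longrightarrow> measure \<mu> A < \<eta> ^ k * u a b \<Longrightarrow> measure \<nu> A \<le> \<rho> ^ k * v a b"
proof -
  obtain \<rho> where \<rho>: "0 \<le> \<rho>" "\<rho> < 1" "dyadic_small \<rho>"
    using ex_dyadic_small by blast
  define \<eta> where "\<eta> = 1 / (4 * D\<^sup>2)"
  have \<eta>: "\<eta> > 0" using X.D_ge_1 by (simp add: \<eta>_def)
  have "measure \<nu> A \<le> \<rho> ^ k * v a b"
    if ab: "a < b" and A: "A \<in> sets borel" "A \<subseteq> {a..<b}" and small: "measure \<mu> A < \<eta> ^ k * u a b" for a b A k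
  proof -
    let ?J = "{a..<b}"
    \<comment> \<open>Restricting \<mu> to the interval gives the finite measure that outer
      regularity requires.\<close>
    let ?M = "density \<mu> (indicator ?J)"
    have em: "emeasure ?M S = emeasure \<mu> (?J \<inter> S)" if "S \<in> sets borel" for S
      using that by (intro emeasure_restricted) auto
    have "emeasure ?M A = (INF V \<in> {V. A \<subseteq> V \<and> open V}. emeasure ?M V)"
    proof (rule outer_regular)
      show "emeasure ?M (space ?M) \<noteq> \<infinity>"
        using X.emeasure_bounded[of ?J] em[of UNIV] by simp
    qed (use A in simp_all)
    moreover have "emeasure ?M A < ennreal (\<eta> ^ k * u a b)"
      using small A em[OF A(1)] X.emeasure_eq[of A] bounded_subset[OF bounded_Ico A(2)]
      by (simp add: Int_absorb1 ennreal_lessI order_le_less_trans[OF measure_nonneg small])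
    ultimately obtain V where V: "A \<subseteq> V" "open V" "emeasure ?M V < ennreal (\<eta> ^ k * u a b)"
      by (auto simp: INF_less_iff)
    have Vb: "V \<inter> ?J \<in> sets borel" using V(2) by simp
    have bdd: "bounded (V \<inter> ?J)" by (rule bounded_subset[OF bounded_Ico]) auto
    have "measure \<mu> (V \<inter> ?J) \<le> \<eta> ^ k * u a b"
      using V(3) em[of V] V(2) X.emeasure_eq[OF bdd] \<eta> by (simp add: Int_commute ennreal_less_iff)
    then have "measure \<nu> (dyadic_inner n a b V) \<le> \<rho> ^ k * v a b" for n
    proof -
      let ?U = "dyadic_inner n a b V"
      have sub: "?U \<subseteq> V \<inter> ?J" by (rule dyadic_inner_subset[OF ab])
      then have eq: "?U \<inter> ?J = ?U" by auto
      have U: "?U \<in> sets borel" using dyadic_borel[OF ab dyadic_dyadic_inner[OF ab]] eq by metis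
      have "measure \<mu> ?U \<le> measure \<mu> (V \<inter> ?J)" using sub U bdd Vb by (intro X.measure_mono_bounded)
      also note \<open>measure \<mu> (V \<inter> ?J) \<le> \<eta> ^ k * u a b\<close>
      finally show ?thesis
        using dyadic_power_small[OF \<rho>(1,3) ab dyadic_dyadic_inner[OF ab, of n V], of k] eq by (simp add: \<eta>_def)
    qed
    moreover have "(\<lambda>n. measure \<nu> (dyadic_inner n a b V)) \<longlonglongrightarrow> measure \<nu> (\<Union>n. dyadic_inner n a b V)"
    proof (rule Lim_measure_incseq)
      show "range (\<lambda>n. dyadic_inner n a b V) \<subseteq> sets \<nu>"
      proof clarsimp
        fix n
        have "dyadic_inner n a b V \<inter> ?J = dyadic_inner n a b V" using dyadic_inner_subset[OF ab] by blast
        then show "dyadic_inner n a b V \<in> sets borel"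
          using dyadic_borel[OF ab dyadic_dyadic_inner[OF ab, of n V]] by simp
      qed
      show "incseq (\<lambda>n. dyadic_inner n a b V)" using dyadic_inner_mono[OF ab] by (rule incseq_SucI)
      show "emeasure \<nu> (\<Union>n. dyadic_inner n a b V) \<noteq> \<infinity>"
        using Y.emeasure_bounded[OF bdd] by (simp add: UN_dyadic_inner[OF V(2) ab])
    qed
    ultimately have "measure \<nu> (V \<inter> ?J) \<le> \<rho> ^ k * v a b"
      unfolding UN_dyadic_inner[OF V(2) ab] by (intro LIMSEQ_le_const2) auto
    moreover have "measure \<nu> A \<le> measure \<nu> (V \<inter> ?J)"
      using A V(1) bdd Vb by (intro Y.measure_mono_bounded) auto
    ultimately show ?thesis by simp
  qed
  then show ?thesis using that \<eta> \<rho>(1,2) by blast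
qed

end

section \<open>The maximal operator\<close>

lemma ennreal_suminf_le:
  fixes f :: "nat \<Rightarrow> ennreal"
  assumes "\<And>N. (\<Sum>n<N. f n) \<le> x" shows "suminf f \<le> x"
  using ennreal_suminf_bound_add[of f 0 x] assms by simp

lemma ennreal_le_suminf: "f n \<le> suminf f" for f :: "nat \<Rightarrow> ennreal"
  using sum_le_suminf[OF summableI, of "{n}" f] by simp

lemma ennreal_suminf_swap:
  fixes f :: "nat \<Rightarrow> nat \<Rightarrow> ennreal"
  shows "(\<Sum>i. \<Sum>j. f i j) = (\<Sum>j. \<Sum>i. f i j)"
  using nn_integral_suminf[of "\<lambda>j i. f i j" "count_space UNIV"]
  by (simp add: nn_integral_count_space_nat)

text \<open>Layer cake from below: if n is least with y <= 2^n c, then 2^n c = c + (sum of 2^k c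
  over k < n), and all these levels lie below y.\<close>

lemma le_dyadic_suminf:
  fixes y c :: real
  assumes "c > 0"
  shows "ennreal y \<le> ennreal c + (\<Sum>k. ennreal (2 ^ k * c) * indicator {y. y > 2 ^ k * c} y)"
proof -
  define n where "n = (LEAST n. y \<le> 2 ^ n * c)"
  have "\<exists>n. y \<le> 2 ^ n * c"
  proof -
    obtain n where "y / c < 2 ^ n" using real_arch_pow[of 2 "y / c"] by auto
    then have "y \<le> 2 ^ n * c" using assms by (simp add: field_simps)
    then show ?thesis by blast
  qed
  then have n: "y \<le> 2 ^ n * c" unfolding n_def by (rule LeastI_ex)
  have k: "y > 2 ^ k * c" if "k < n" for k
    using not_less_Least[of k "\<lambda>n. y \<le> 2 ^ n * c"] that by (simp add: n_def)
  have geo: "2 ^ n * c = c + (\<Sum>k<n. 2 ^ k * c)" for n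
    by (induction n) (auto simp: algebra_simps)
  have "ennreal y \<le> ennreal (2 ^ n * c)" using n by (rule ennreal_leI)
  also have "\<dots> = ennreal c + (\<Sum>k<n. ennreal (2 ^ k * c))"
    unfolding geo[of n] using assms by (simp add: sum_nonneg)
  also have "(\<Sum>k<n. ennreal (2 ^ k * c)) = (\<Sum>k<n. ennreal (2 ^ k * c) * indicator {y. y > 2 ^ k * c} y)"
    using k by (intro sum.cong) auto
  also have "\<dots> \<le> (\<Sum>k. ennreal (2 ^ k * c) * indicator {y. y > 2 ^ k * c} y)"
    by (intro sum_le_suminf summableI) auto
  finally show ?thesis by simp
qed

lemma dyadic_scale:
  fixes y :: real
  assumes "y > 0"
  obtains j :: int where "2 powr j < y" "y \<le> 2 powr (j + 1)"
proof
  \<comment> \<open>Ceiling minus one, not floor: the lower inequality must be strict.\<close>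
  define j where "j = \<lceil>log 2 y\<rceil> - 1"
  have j: "real_of_int j < log 2 y" "log 2 y \<le> real_of_int j + 1" unfolding j_def by linarith+
  show "2 powr j < y" using j(1) assms by (simp add: less_log_iff)
  show "y \<le> 2 powr (j + 1)" using j(2) assms by (simp add: log_le_iff)
qed

text \<open>As p >= 1, the terms decay at least geometrically with ratio 1/2 below the largest
  index, so the sum is at most twice its top term.\<close>

lemma sum_dyadic_powr_le:
  fixes y p :: real
  assumes y: "y \<ge> 0" and p: "p \<ge> 1" and I: "finite I" "\<And>j. j \<in> I \<Longrightarrow> 2 powr real_of_int j < y"
  shows "(\<Sum>j\<in>I. 2 powr ((real_of_int j + 1) * p)) \<le> 2 * 2 powr p * y powr p"
proof (cases "I = {}")
  case False
  define J where "J = Max I"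
  have J: "J \<in> I" "\<And>j. j \<in> I \<Longrightarrow> j \<le> J" using I(1) False by (auto simp: J_def)
  have "(\<Sum>j\<in>I. 2 powr ((real_of_int j + 1) * p)) \<le> (\<Sum>j\<in>I. 2 powr ((J + 1) * p) * (1 / 2) ^ nat (J - j))"
  proof (rule sum_mono)
    fix j assume j: "j \<in> I"
    have "(real_of_int j + 1) * p = (J + 1) * p - (J - j) * p" by (simp add: algebra_simps)
    also have "\<dots> \<le> (J + 1) * p - real (nat (J - j))"
      using mult_left_mono[of 1 p "real_of_int (J - j)"] p J(2)[OF j] by simp
    finally have "2 powr ((real_of_int j + 1) * p) \<le> 2 powr ((J + 1) * p - real (nat (J - j)))" by simp
    also have "\<dots> = 2 powr ((J + 1) * p) * (1 / 2) ^ nat (J - j)"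
      by (simp add: powr_diff powr_realpow power_one_over field_simps)
    finally show "2 powr ((real_of_int j + 1) * p) \<le> 2 powr ((J + 1) * p) * (1 / 2) ^ nat (J - j)" .
  qed
  also have "\<dots> = 2 powr ((J + 1) * p) * (\<Sum>j\<in>I. (1 / 2) ^ nat (J - j))"
    by (simp add: sum_distrib_left)
  also have "(\<Sum>j\<in>I. (1 / 2 :: real) ^ nat (J - j)) = (\<Sum>i\<in>(\<lambda>j. nat (J - j)) ` I. (1 / 2) ^ i)"
  proof (subst sum.reindex)
    show "inj_on (\<lambda>j. nat (J - j)) I"
      using J(2) by (intro inj_onI) (metis diff_ge_0_iff_ge diff_left_imp_eq eq_nat_nat_iff)
  qed simp
  also have "\<dots> \<le> (\<Sum>i. (1 / 2) ^ i)"
    using I(1) by (intro sum_le_suminf summable_geometric) auto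
  also have "(\<Sum>i. (1 / 2 :: real) ^ i) = 2" by (subst suminf_geometric) auto
  also have "2 powr ((J + 1) * p) = 2 powr p * (2 powr J) powr p"
    by (simp add: powr_powr powr_add[symmetric] algebra_simps)
  also have "\<dots> \<le> 2 powr p * y powr p"
    using I(2)[OF J(1)] p by (intro mult_left_mono powr_mono2) auto
  finally show ?thesis by simp
qed (use assms in auto)

section \<open>Covering by balls in which a set is dense\<close>

context doubling
begin

lemma emeasure_cball_le:
  assumes "r > 0" "\<epsilon> > 0" "\<epsilon> * measure M (ball c r) \<le> measure M (ball c r \<inter> A)"
  shows "emeasure M (cball c (10 * r)) \<le> ennreal (D ^ 4 / \<epsilon>) * emeasure M (ball c r \<inter> A)"
proof -
  have "measure M (cball c (10 * r)) \<le> D ^ 4 * measure M (ball c r)"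
    using assms by (intro measure_le_ball) (auto simp: mem_cball mem_ball)
  also have "\<dots> \<le> D ^ 4 * (measure M (ball c r \<inter> A) / \<epsilon>)"
    using assms D_ge_1 by (intro mult_left_mono) (auto simp: field_simps)
  finally have "ennreal (measure M (cball c (10 * r))) \<le> ennreal (D ^ 4 / \<epsilon> * measure M (ball c r \<inter> A))"
    by (intro ennreal_leI) simp
  then show ?thesis
    using assms(2) D_ge_1 by (simp add: emeasure_eq bounded_Int ennreal_mult[symmetric])
qed

text \<open>The covering lemma is applied to the doubled balls, since their union is to be covered.
  Its fivefold dilates have radius 10 r, within 16 r, hence D^4; disjoint doubled balls make the
  traces of A on the original balls disjoint.\<close>

lemma vitali_bounded_radius:
  assumes A: "A \<in> sets borel" and "\<epsilon> > 0"
    and F: "\<And>c r. (c, r) \<in> F \<Longrightarrow> 0 < r \<and> r \<le> R \<and> \<epsilon> * measure M (ball c r) \<le> measure M (ball c r \<inter> A)"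
  shows "emeasure M (\<Union>(c, r)\<in>F. ball c (2 * r)) \<le> ennreal (D ^ 4 / \<epsilon>) * emeasure M A"
proof -
  obtain Q where Q: "countable Q" "Q \<subseteq> F"
     "pairwise (\<lambda>i j. disjnt (cball (fst i) (2 * snd i)) (cball (fst j) (2 * snd j))) Q"
     "(\<Union>(c, r)\<in>F. ball c (2 * r)) \<subseteq> (\<Union>i\<in>Q. cball (fst i) (5 * (2 * snd i)))"
  proof (rule Vitali_covering_lemma_cballs[where S="\<Union>(c, r)\<in>F. ball c (2 * r)" and K=F and a=fst and r="\<lambda>i. 2 * snd i" and B="2 * R"])
    show "(\<Union>(c, r)\<in>F. ball c (2 * r)) \<subseteq> (\<Union>i\<in>F. cball (fst i) (2 * snd i))"
      by fastforce
    show "0 < 2 * snd i \<and> 2 * snd i \<le> 2 * R" if "i \<in> F" for i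
      using F[of "fst i" "snd i"] that by auto
  qed
  \<comment> \<open>The countable subfamily is indexed by naturals and padded with empty
    sets.\<close>
  define N where "N = to_nat_on Q ` Q"
  define q where "q = from_nat_into Q"
  have q: "q n \<in> Q" if "n \<in> N" for n
    using that Q(1) by (auto simp: N_def q_def)
  have q_inj: "n = m" if "n \<in> N" "m \<in> N" "q n = q m" for n m
    using that Q(1) by (auto simp: N_def q_def)
  define Z where "Z n = (if n \<in> N then cball (fst (q n)) (10 * snd (q n)) else {})" for n
  define Y where "Y n = (if n \<in> N then ball (fst (q n)) (snd (q n)) \<inter> A else {})" for n
  have "(\<Union>(c, r)\<in>F. ball c (2 * r)) \<subseteq> (\<Union>n. Z n)"
  proof
    fix x assume "x \<in> (\<Union>(c, r)\<in>F. ball c (2 * r))"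
    from subsetD[OF Q(4) this] obtain i where "i \<in> Q" "x \<in> cball (fst i) (5 * (2 * snd i))"
      by blast
    then have i: "i \<in> Q" "x \<in> cball (fst i) (10 * snd i)" by simp_all
    then have "to_nat_on Q i \<in> N" "q (to_nat_on Q i) = i" using Q(1) by (auto simp: N_def q_def)
    then have "x \<in> Z (to_nat_on Q i)" using i by (simp add: Z_def)
    then show "x \<in> (\<Union>n. Z n)" by blast
  qed
  then have "emeasure M (\<Union>(c, r)\<in>F. ball c (2 * r)) \<le> emeasure M (\<Union>n. Z n)"
    by (rule emeasure_mono) (auto simp: Z_def)
  also have "\<dots> \<le> (\<Sum>n. emeasure M (Z n))"
    by (rule emeasure_subadditive_countably) (auto simp: Z_def)
  also have "\<dots> \<le> (\<Sum>n. ennreal (D ^ 4 / \<epsilon>) * emeasure M (Y n))"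
  proof (intro suminf_le summableI)
    show "emeasure M (Z n) \<le> ennreal (D ^ 4 / \<epsilon>) * emeasure M (Y n)" for n
    proof (cases "n \<in> N")
      case True
      then have "(fst (q n), snd (q n)) \<in> F" using q Q(2) by auto
      then show ?thesis
        using F[of "fst (q n)" "snd (q n)"] True \<open>\<epsilon> > 0\<close>
        by (auto simp: Z_def Y_def intro!: emeasure_cball_le)
    qed (simp add: Z_def)
  qed
  also have "\<dots> = ennreal (D ^ 4 / \<epsilon>) * emeasure M (\<Union>n. Y n)"
  proof -
    have "disjoint_family Y"
      unfolding disjoint_family_on_def
    proof (intro ballI impI)
      fix n m :: nat assume "n \<noteq> m"
      show "Y n \<inter> Y m = {}"
      proof (cases "n \<in> N \<and> m \<in> N")
        case True
        then have "q n \<noteq> q m" using q_inj \<open>n \<noteq> m\<close> by blast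
        then have "disjnt (cball (fst (q n)) (2 * snd (q n))) (cball (fst (q m)) (2 * snd (q m)))"
          using Q(3) q True by (auto simp: pairwise_def)
        moreover have "ball (fst i) (snd i) \<subseteq> cball (fst i) (2 * snd i)" if "i \<in> Q" for i
          using F[of "fst i" "snd i"] that Q(2) by (force simp: mem_ball mem_cball)
        ultimately have "ball (fst (q n)) (snd (q n)) \<inter> ball (fst (q m)) (snd (q m)) = {}"
          using q True unfolding disjnt_def by blast
        then show ?thesis using True by (auto simp only: Y_def if_True)
      qed (auto simp: Y_def)
    qed
    moreover have "range Y \<subseteq> sets M" using A by (auto simp: Y_def)
    ultimately show ?thesis by (simp add: suminf_emeasure)
  qed
  also have "\<dots> \<le> ennreal (D ^ 4 / \<epsilon>) * emeasure M A"
    using A by (intro mult_left_mono emeasure_mono) (auto simp: Y_def)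
  finally show ?thesis .
qed

definition dense_balls :: "real \<Rightarrow> real set \<Rightarrow> (real \<times> real) set" where
  "dense_balls \<epsilon> A = {(c, r). 0 < r \<and> \<epsilon> * measure M (ball c r) \<le> measure M (ball c r \<inter> A)}"

text \<open>An open majorant of a superlevel set of the maximal function of
  \<open>indicator A\<close> under M. Doubling the radius takes in the endpoints of an interval
  whose interior is the ball.\<close>

definition dense_points :: "real \<Rightarrow> real set \<Rightarrow> real set" where
  "dense_points \<epsilon> A = (\<Union>(c, r)\<in>dense_balls \<epsilon> A. ball c (2 * r))"

lemma dense_points_borel [measurable, simp]: "dense_points \<epsilon> A \<in> sets borel"
  unfolding dense_points_def by (intro borel_open open_UN) auto

text \<open>The Vitali bound does not depend on the radius limit, so the limit n is removed by
  continuity from below.\<close>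

lemma emeasure_dense_points:
  assumes A: "A \<in> sets borel" and "\<epsilon> > 0"
  shows "emeasure M (dense_points \<epsilon> A) \<le> ennreal (D ^ 4 / \<epsilon>) * emeasure M A"
proof -
  define F where "F n = dense_balls \<epsilon> A \<inter> {(c, r). r \<le> real n}" for n
  define U where "U n = (\<Union>(c, r)\<in>F n. ball c (2 * r))" for n
  have "dense_points \<epsilon> A = (\<Union>n. U n)"
  proof (intro antisym subsetI)
    fix x assume "x \<in> dense_points \<epsilon> A"
    then obtain c r where "(c, r) \<in> dense_balls \<epsilon> A" "x \<in> ball c (2 * r)" by (auto simp: dense_points_def)
    moreover obtain n :: nat where "r \<le> n" using real_arch_simple by blast
    ultimately show "x \<in> (\<Union>n. U n)" by (force simp: U_def F_def)
  qed (auto simp: dense_points_def U_def F_def)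
  also have "emeasure M (\<Union>n. U n) = (SUP n. emeasure M (U n))"
  proof (rule SUP_emeasure_incseq[symmetric])
    show "range U \<subseteq> sets M" by (auto simp: U_def intro!: borel_open open_UN)
    have "F n \<subseteq> F (Suc n)" for n by (auto simp: F_def)
    then show "incseq U" unfolding U_def by (intro incseq_SucI UN_mono) auto
  qed
  also have "\<dots> \<le> ennreal (D ^ 4 / \<epsilon>) * emeasure M A"
    unfolding U_def
    by (intro SUP_least vitali_bounded_radius[where R="real _"] assms) (auto simp: F_def dense_balls_def)
  finally show ?thesis .
qed

lemma emeasure_singleton: "emeasure M {x} = 0"
  by (simp add: emeasure_eq measure_point)

lemma AE_ne: "AE y in M. y \<noteq> x"
  by (rule AE_I[of _ _ "{x}"]) (auto simp: emeasure_singleton)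

text \<open>Since points are null, only infimum and supremum of I matter. The given x may be the
  right endpoint, hence the closed \<open>{a..b}\<close>.\<close>

lemma interval_Ico:
  assumes "is_interval I" "bounded I" "interior I \<noteq> {}" "x \<in> I"
  obtains a b where "a < b" "x \<in> {a..b}" "AE y in M. y \<in> I \<longleftrightarrow> y \<in> {a..<b}" "I \<in> sets borel"
proof -
  define a b where "a = Inf I" and "b = Sup I"
  have bdd: "bdd_below I" "bdd_above I" using assms(2) by (simp_all add: bounded_imp_bdd_below bounded_imp_bdd_above)
  have sub: "I \<subseteq> {a..b}"
    using bdd by (auto simp: a_def b_def intro: cInf_lower cSup_upper)
  have sup: "{a<..<b} \<subseteq> I"
  proof
    fix y assume "y \<in> {a<..<b}"
    then obtain s t where "s \<in> I" "s < y" "t \<in> I" "y < t"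
      using assms(4) by (metis a_def b_def cInf_lessD less_cSupD empty_iff greaterThanLessThan_iff)
    then show "y \<in> I" using assms(1) by (meson is_interval_1 less_imp_le)
  qed
  have ab: "a < b"
  proof (rule ccontr)
    assume "\<not> a < b"
    then have "{a..b} \<subseteq> {a}" by auto
    then have "interior I \<subseteq> interior {a}" using sub by (intro interior_mono) blast
    then show False using assms(3) by simp
  qed
  have "AE y in M. y \<in> I \<longleftrightarrow> y \<in> {a..<b}"
    using AE_ne[of a] AE_ne[of b]
  proof eventually_elim
    case (elim y)
    have "a < y \<and> y < b" if "y \<in> I" using subsetD[OF sub that] elim by auto
    moreover have "y \<in> I" if "a < y" "y < b" using sup that by auto
    ultimately show ?case using elim by auto
  qed
  moreover have "I \<in> sets borel"
  proof -
    have "y \<in> {a<..<b} \<union> (I \<inter> {a, b})" if "y \<in> I" for y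
      using subsetD[OF sub that] that by auto
    then have "I = {a<..<b} \<union> (I \<inter> {a, b})" using sup by blast
    moreover have "{a<..<b} \<union> (I \<inter> {a, b}) \<in> sets borel"
      by (intro sets.Un borel_open borel_closed finite_imp_closed) auto
    ultimately show ?thesis by simp
  qed
  ultimately show ?thesis using that[of a b] ab sub assms(4) by blast
qed

end

section \<open>Superlevel sets and the L^p bound\<close>

context carleson_pair
begin

text \<open>A power m with \<rho>^m < 1/4 replaces \<rho>, at the price \<delta> = \<eta>^m. The
  decay 4^-k has to beat the growth 2^k of the levels in the layer cake.\<close>

lemma quarter_small:
  obtains \<delta> where "0 < \<delta>" "\<And>a b A k. a < b \<Longrightarrow> A \<in> sets borel \<Longrightarrow> A \<subseteq> {a..<b} \<Longrightarrow>
    measure \<mu> A < \<delta> ^ k * u a b \<Longrightarrow> measure \<nu> A \<le> (1 / 4) ^ k * v a b"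
proof -
  obtain \<eta> \<rho> where \<eta>: "0 < \<eta>" "0 \<le> \<rho>" "\<rho> < 1"
    "\<And>a b A k. a < b \<Longrightarrow> A \<in> sets borel \<Longrightarrow> A \<subseteq> {a..<b} \<Longrightarrow> measure \<mu> A < \<eta> ^ k * u a b \<Longrightarrow> measure \<nu> A \<le> \<rho> ^ k * v a b"
    using borel_power_small by blast
  obtain m where m: "\<rho> ^ m < 1 / 4" using real_arch_pow_inv[of "1 / 4" \<rho>] \<eta> by auto
  have "measure \<nu> A \<le> (1 / 4) ^ k * v a b"
    if "a < b" "A \<in> sets borel" "A \<subseteq> {a..<b}" "measure \<mu> A < (\<eta> ^ m) ^ k * u a b" for a b A k
  proof -
    have "measure \<nu> A \<le> (\<rho> ^ m) ^ k * v a b"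
      using \<eta>(4)[OF that(1-3), of "m * k"] that(4) by (simp add: power_mult)
    also have "\<dots> \<le> (1 / 4) ^ k * v a b"
      using m \<eta>(2) by (intro mult_right_mono power_mono) auto
    finally show ?thesis .
  qed
  then show ?thesis using that[of "\<eta> ^ m"] \<eta>(1) by simp
qed

text \<open>If every level set were \<mu>-sparse, the layer cake would bound the integral by l v/4
  plus the sum of 2^k (l/4) 4^-(k+1) v, which is 3/8 l v in total.\<close>

lemma average_large_imp_dense:
  assumes \<delta>: "\<delta> > 0" "\<And>a b A k. a < b \<Longrightarrow> A \<in> sets borel \<Longrightarrow> A \<subseteq> {a..<b} \<Longrightarrow>
      measure \<mu> A < \<delta> ^ k * u a b \<Longrightarrow> measure \<nu> A \<le> (1 / 4) ^ k * v a b"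
    and ab: "a < b" and g: "g \<in> borel_measurable borel" and l: "l > 0"
    and large: "ennreal (l * v a b) < (\<integral>\<^sup>+ y\<in>{a..<b}. ennreal (g y) \<partial>\<nu>)"
  shows "\<exists>k. \<delta> ^ (k + 1) * u a b \<le> measure \<mu> ({a..<b} \<inter> {y. g y > 2 ^ k * (l / 4)})"
proof (rule ccontr)
  assume "\<not> ?thesis"
  then have neg: "measure \<mu> ({a..<b} \<inter> {y. g y > 2 ^ k * (l / 4)}) < \<delta> ^ (k + 1) * u a b" for k
    by (simp add: not_le)
  define S where "S k = {a..<b} \<inter> {y. g y > 2 ^ k * (l / 4)}" for k
  have S: "S k \<in> sets borel" "S k \<subseteq> {a..<b}" "bounded (S k)" for k
    using g by (auto simp: S_def intro: bounded_subset[OF bounded_Ico])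
  have Sle: "measure \<nu> (S k) \<le> (1 / 4) ^ (k + 1) * v a b" for k
    using neg[of k] S(1,2) by (intro \<delta>(2) ab) (auto simp: S_def)
  have "(\<integral>\<^sup>+ y\<in>{a..<b}. ennreal (g y) \<partial>\<nu>) \<le>
     (\<integral>\<^sup>+ y. ennreal (l / 4) * indicator {a..<b} y + (\<Sum>k. ennreal (2 ^ k * (l / 4)) * indicator (S k) y) \<partial>\<nu>)"
  proof (rule nn_integral_mono)
    fix y
    show "ennreal (g y) * indicator {a..<b} y \<le>
      ennreal (l / 4) * indicator {a..<b} y + (\<Sum>k. ennreal (2 ^ k * (l / 4)) * indicator (S k) y)"
    proof (cases "y \<in> {a..<b}")
      case True
      then have "indicator (S k) y = (indicator {z. z > 2 ^ k * (l / 4)} (g y) :: ennreal)" for k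
        by (auto simp: S_def indicator_def)
      then show ?thesis using le_dyadic_suminf[of "l / 4" "g y"] l True by simp
    qed simp
  qed
  also have "\<dots> = ennreal (l / 4) * emeasure \<nu> {a..<b} + (\<Sum>k. ennreal (2 ^ k * (l / 4)) * emeasure \<nu> (S k))"
    using S(1) by (simp add: nn_integral_add nn_integral_suminf nn_integral_cmult_indicator)
  also have "\<dots> \<le> ennreal (l / 4 * v a b) + (\<Sum>k. ennreal (l * v a b / 16 * (1 / 2) ^ k))"
  proof (intro add_mono suminf_le summableI)
    show "ennreal (l / 4) * emeasure \<nu> {a..<b} \<le> ennreal (l / 4 * v a b)"
      using l bounded_Ico by (simp add: Y.emeasure_eq ennreal_mult[symmetric])
    show "ennreal (2 ^ k * (l / 4)) * emeasure \<nu> (S k) \<le> ennreal (l * v a b / 16 * (1 / 2) ^ k)" for k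
    proof -
      have "ennreal (2 ^ k * (l / 4)) * emeasure \<nu> (S k) = ennreal (2 ^ k * (l / 4) * measure \<nu> (S k))"
        using l S(3) by (simp add: Y.emeasure_eq ennreal_mult[symmetric])
      also have "\<dots> \<le> ennreal (2 ^ k * (l / 4) * ((1 / 4) ^ (k + 1) * v a b))"
        using l by (intro ennreal_leI mult_left_mono Sle) auto
      also have "2 ^ k * (l / 4) * ((1 / 4) ^ (k + 1) * v a b) = l * v a b / 16 * (2 * (1 / 4)) ^ k"
        unfolding power_mult_distrib by simp
      finally show ?thesis by simp
    qed
  qed
  also have "(\<Sum>k. ennreal (l * v a b / 16 * (1 / 2) ^ k)) = ennreal (l * v a b / 16 * 2)"
  proof (rule suminf_ennreal_eq)
    show "(\<lambda>k. l * v a b / 16 * (1 / 2) ^ k) sums (l * v a b / 16 * 2)"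
      using geometric_sums[of "1 / 2 :: real"] by (intro sums_mult) simp
  qed (use l in auto)
  also have "ennreal (l / 4 * v a b) + ennreal (l * v a b / 16 * 2) \<le> ennreal (l * v a b)"
    using l by (subst ennreal_plus[symmetric]) (auto intro!: ennreal_leI)
  finally show False using large by simp
qed

text \<open>The interval witnessing a large average is replaced by [a,b) for \<nu> and by the ball
  (a,b) for \<mu>, each up to null sets. The level k depends on that interval, hence the
  union.\<close>

lemma maxop_superlevel:
  assumes \<delta>: "\<delta> > 0" "\<And>a b A k. a < b \<Longrightarrow> A \<in> sets borel \<Longrightarrow> A \<subseteq> {a..<b} \<Longrightarrow>
      measure \<mu> A < \<delta> ^ k * u a b \<Longrightarrow> measure \<nu> A \<le> (1 / 4) ^ k * v a b"
    and f: "f \<in> borel_measurable borel" and l: "l > 0" and x: "ennreal l < maxop \<nu> f x"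
  shows "x \<in> (\<Union>k. X.dense_points (\<delta> ^ (k + 1)) {y. \<bar>f y\<bar> > 2 ^ k * (l / 4)})"
proof -
  obtain I where I: "is_interval I" "bounded I" "interior I \<noteq> {}" "x \<in> I"
    and lI: "ennreal l < (\<integral>\<^sup>+ y\<in>I. ennreal \<bar>f y\<bar> \<partial>\<nu>) / emeasure \<nu> I"
    using x unfolding maxop_def less_SUP_iff by blast
  obtain a b where ab: "a < b" "x \<in> {a..b}" and AE: "AE y in \<nu>. y \<in> I \<longleftrightarrow> y \<in> {a..<b}" and Ib: "I \<in> sets borel"
    using Y.interval_Ico[OF I] by blast
  have "emeasure \<nu> I = emeasure \<nu> {a..<b}"
    using AE Ib by (intro emeasure_eq_AE) auto
  then have \<nu>I: "emeasure \<nu> I = ennreal (v a b)" by (simp add: Y.emeasure_eq bounded_Ico)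
  have "(\<integral>\<^sup>+ y\<in>I. ennreal \<bar>f y\<bar> \<partial>\<nu>) = (\<integral>\<^sup>+ y\<in>{a..<b}. ennreal \<bar>f y\<bar> \<partial>\<nu>)"
    using AE by (intro nn_integral_cong_AE) (auto simp: indicator_def elim: eventually_mono)
  then have "ennreal l < (\<integral>\<^sup>+ y\<in>{a..<b}. ennreal \<bar>f y\<bar> \<partial>\<nu>) / ennreal (v a b)"
    using lI \<nu>I by simp
  then have "ennreal l * ennreal (v a b) < (\<integral>\<^sup>+ y\<in>{a..<b}. ennreal \<bar>f y\<bar> \<partial>\<nu>)"
    using v_pos[OF ab(1)] by (metis divide_le_posI_ennreal ennreal_less_zero_iff mult.commute not_le)
  then have "ennreal (l * v a b) < (\<integral>\<^sup>+ y\<in>{a..<b}. ennreal \<bar>f y\<bar> \<partial>\<nu>)"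
    using l by (simp add: ennreal_mult)
  then obtain k where k: "\<delta> ^ (k + 1) * u a b \<le> measure \<mu> ({a..<b} \<inter> {y. \<bar>f y\<bar> > 2 ^ k * (l / 4)})"
    using average_large_imp_dense[OF \<delta> ab(1) borel_measurable_abs[OF f] l] by blast
  define c r where "c = (a + b) / 2" and "r = (b - a) / 2"
  have r: "r > 0" and ball: "ball c r = {a<..<b}"
    using ab(1) by (auto simp: c_def r_def ball_eq_greaterThanLessThan field_simps)
  have AE': "AE y in \<mu>. y \<in> ball c r \<longleftrightarrow> y \<in> {a..<b}"
    using X.AE_ne[of a] by eventually_elim (auto simp: ball)
  have m1: "measure \<mu> (ball c r) = u a b"
    using AE' by (intro measure_eq_AE) auto
  have m2: "measure \<mu> (ball c r \<inter> {y. \<bar>f y\<bar> > 2 ^ k * (l / 4)}) = measure \<mu> ({a..<b} \<inter> {y. \<bar>f y\<bar> > 2 ^ k * (l / 4)})"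
    using AE' f by (intro measure_eq_AE) (auto elim: eventually_mono)
  have "(c, r) \<in> X.dense_balls (\<delta> ^ (k + 1)) {y. \<bar>f y\<bar> > 2 ^ k * (l / 4)}"
    unfolding X.dense_balls_def using k r m1 m2 by simp
  moreover have "x \<in> ball c (2 * r)"
    using ab by (auto simp: ball_eq_greaterThanLessThan c_def r_def field_simps)
  ultimately show ?thesis unfolding X.dense_points_def by blast
qed

lemma A_infty: "A_infty \<mu> \<nu>"
proof -
  obtain \<delta> where \<delta>: "\<delta> > 0" "\<And>a b A k. a < b \<Longrightarrow> A \<in> sets borel \<Longrightarrow> A \<subseteq> {a..<b} \<Longrightarrow>
      measure \<mu> A < \<delta> ^ k * u a b \<Longrightarrow> measure \<nu> A \<le> (1 / 4) ^ k * v a b"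
    using quarter_small by blast
  \<comment> \<open>Fixes the exponent p = m + 1 so that the decay 2^-p of the level integrals beats
    the loss 1/\<delta> per level of the covering bound, with ratio at most 1/2.\<close>
  obtain m where m: "(1 / 2) ^ m < \<delta> / 2" using real_arch_pow_inv[of "\<delta> / 2" "1 / 2"] \<delta>(1) by auto
  define p where "p = real (Suc m)"
  have p: "p \<ge> 1" by (simp add: p_def)
  have "2 powr (- p) = (1 / 2) ^ Suc m"
    by (simp add: p_def powr_minus powr_realpow power_one_over inverse_eq_divide del: of_nat_Suc power_Suc)
  also have "\<dots> \<le> (1 / 2) ^ m" by simp
  finally have p\<delta>: "2 powr (- p) / \<delta> \<le> 1 / 2"
    using m \<delta>(1) by (simp add: pos_divide_le_eq)
  \<comment> \<open>\<open>L n\<close> runs through all 2^j with j an integer; \<open>c n\<close> is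
    the largest p-th power of a value in (2^j, 2^(j+1)].\<close>
  define L :: "nat \<Rightarrow> real" where "L n = 2 powr real_of_int (int_decode n)" for n
  define c :: "nat \<Rightarrow> real" where "c n = 2 powr ((real_of_int (int_decode n) + 1) * p)" for n
  define d :: "nat \<Rightarrow> real" where "d k = D ^ 4 / \<delta> ^ (k + 1)" for k
  have Lpos: "L n > 0" for n by (simp add: L_def)
  have cpos: "c n \<ge> 0" for n by (simp add: c_def)
  have dpos: "d k \<ge> 0" for k using \<delta>(1) X.D_ge_1 by (simp add: d_def)
  \<comment> \<open>Of 4 = 2 * 2, one factor comes from summing over j and one from the series in k.
    In 8^p = 2^p * 4^p, 2^p is the rounding up to 2^(j+1) and 4^p the threshold
    \<open>L n / 4\<close>.\<close>
  define K where "K = 4 * 8 powr p * (D ^ 4 / \<delta>)"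
  have "maxop_bounded_Lp \<nu> \<mu> p"
    unfolding maxop_bounded_Lp_def
  proof (intro exI[of _ K] ballI impI)
    fix f :: "real \<Rightarrow> real" assume f: "f \<in> borel_measurable borel"
    define S where "S n k = {y. \<bar>f y\<bar> > 2 ^ k * (L n / 4)}" for n k
    have S: "S n k \<in> sets borel" for n k using f by (simp add: S_def)
    define W where "W n = (\<Union>k. X.dense_points (\<delta> ^ (k + 1)) (S n k))" for n
    have W: "W n \<in> sets borel" for n by (auto simp: W_def)
    have mem_W: "x \<in> W n" if "ennreal (L n) < maxop \<nu> f x" for x n
      unfolding W_def S_def by (rule maxop_superlevel[OF \<delta> f Lpos that])
    have emW: "emeasure \<mu> (W n) \<le> (\<Sum>k. ennreal (d k) * emeasure \<mu> (S n k))" for n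
    proof -
      have "emeasure \<mu> (W n) \<le> (\<Sum>k. emeasure \<mu> (X.dense_points (\<delta> ^ (k + 1)) (S n k)))"
        unfolding W_def by (rule emeasure_subadditive_countably) auto
      also have "\<dots> \<le> (\<Sum>k. ennreal (d k) * emeasure \<mu> (S n k))"
        unfolding d_def using \<delta>(1) S by (intro suminf_le summableI X.emeasure_dense_points) auto
      finally show ?thesis .
    qed
    have real_le: "ennreal (t powr p) \<le> (\<Sum>n. ennreal (c n) * indicator (W n) x)"
      if t: "t > 0" "ennreal t \<le> maxop \<nu> f x" for x t
    proof -
      obtain j :: int where j: "2 powr j < t" "t \<le> 2 powr (j + 1)" using dyadic_scale[OF t(1)] by blast
      define n where "n = int_encode j"
      have "ennreal (L n) < ennreal t" using j(1) by (simp add: L_def n_def ennreal_less_iff)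
      then have x: "x \<in> W n" using t(2) by (intro mem_W) auto
      have "t powr p \<le> (2 powr (j + 1)) powr p" using j(2) t(1) p by (intro powr_mono2) auto
      also have "\<dots> = c n" by (simp add: c_def n_def powr_powr)
      finally have "ennreal (t powr p) \<le> ennreal (c n) * indicator (W n) x" using x by (simp add: ennreal_leI)
      also have "\<dots> \<le> (\<Sum>n. ennreal (c n) * indicator (W n) x)"
        by (rule ennreal_le_suminf)
      finally show ?thesis .
    qed
    have point: "enn_powr (maxop \<nu> f x) p \<le> (\<Sum>n. ennreal (c n) * indicator (W n) x)" for x
    proof (cases "maxop \<nu> f x = \<infinity>")
      case True
      \<comment> \<open>An infinite value dominates every real t, so \<open>real_le\<close> makes
        the series exceed every natural number.\<close>
      have "ennreal (real N) \<le> (\<Sum>n. ennreal (c n) * indicator (W n) x)" for N :: nat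
      proof -
        have "real N \<le> (real N + 1) powr 1" by simp
        also have "\<dots> \<le> (real N + 1) powr p" using p by (intro powr_mono) auto
        finally have "ennreal (real N) \<le> ennreal ((real N + 1) powr p)" by (rule ennreal_leI)
        also have "\<dots> \<le> (\<Sum>n. ennreal (c n) * indicator (W n) x)" using True by (intro real_le) auto
        finally show ?thesis .
      qed
      then have "(\<Sum>n. ennreal (c n) * indicator (W n) x) = top"
        using ennreal_Ex_less_of_nat[of "\<Sum>n. ennreal (c n) * indicator (W n) x"]
        by (metis ennreal_of_nat_eq_real_of_nat not_le top.not_eq_extremum)
      then show ?thesis by simp
    next
      case False
      then obtain t where t: "maxop \<nu> f x = ennreal t" "t \<ge> 0" by (cases "maxop \<nu> f x") auto
      then show ?thesis
        using real_le[of t x] p by (cases "t = 0") (auto simp: enn_powr_def)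
    qed
    have "(\<integral>\<^sup>+ x. enn_powr (maxop \<nu> f x) p \<partial>\<mu>) \<le> (\<integral>\<^sup>+ x. (\<Sum>n. ennreal (c n) * indicator (W n) x) \<partial>\<mu>)"
      by (intro nn_integral_mono point)
    also have "\<dots> = (\<Sum>n. ennreal (c n) * emeasure \<mu> (W n))"
      using W by (simp add: nn_integral_suminf nn_integral_cmult_indicator)
    also have "\<dots> \<le> (\<Sum>n. ennreal (c n) * (\<Sum>k. ennreal (d k) * emeasure \<mu> (S n k)))"
      by (intro suminf_le summableI mult_left_mono emW) auto
    also have "\<dots> = (\<Sum>k. ennreal (d k) * (\<Sum>n. ennreal (c n) * emeasure \<mu> (S n k)))"
    proof -
      have "(\<Sum>n. ennreal (c n) * (\<Sum>k. ennreal (d k) * emeasure \<mu> (S n k)))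
        = (\<Sum>n. \<Sum>k. ennreal (c n) * (ennreal (d k) * emeasure \<mu> (S n k)))" by simp
      also have "\<dots> = (\<Sum>k. \<Sum>n. ennreal (d k) * (ennreal (c n) * emeasure \<mu> (S n k)))"
        by (subst ennreal_suminf_swap) (simp only: mult.left_commute)
      finally show ?thesis by simp
    qed
    also have "\<dots> = (\<integral>\<^sup>+ x. (\<Sum>k. ennreal (d k) * (\<Sum>n. ennreal (c n) * indicator (S n k) x)) \<partial>\<mu>)"
      using S by (simp add: nn_integral_suminf nn_integral_cmult nn_integral_cmult_indicator del: ennreal_suminf_cmult)
    also have "\<dots> \<le> (\<integral>\<^sup>+ x. ennreal K * ennreal (\<bar>f x\<bar> powr p) \<partial>\<mu>)"
    proof (rule nn_integral_mono)
      fix x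
      let ?y = "\<bar>f x\<bar>"
      \<comment> \<open>Membership of x in \<open>S n k\<close> means 2^j < 4 |f x| / 2^k, so the
        sum over n is a sum over dyadic levels below that number; its p-th power supplies the decay
        in k.\<close>
      have inner: "(\<Sum>n. ennreal (c n) * indicator (S n k) x) \<le> ennreal (2 * 8 powr p * (2 powr (- p)) ^ k * ?y powr p)" for k
      proof (rule ennreal_suminf_le)
        fix N
        define I where "I = int_decode ` {n \<in> {..<N}. x \<in> S n k}"
        have "(\<Sum>n<N. ennreal (c n) * indicator (S n k) x) = (\<Sum>n\<in>{n \<in> {..<N}. x \<in> S n k}. ennreal (c n))"
          by (simp add: indicator_def if_distrib Int_def cong: if_cong)
        also have "\<dots> = ennreal (\<Sum>n\<in>{n \<in> {..<N}. x \<in> S n k}. c n)"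
          using cpos by simp
        also have "(\<Sum>n\<in>{n \<in> {..<N}. x \<in> S n k}. c n) = (\<Sum>j\<in>I. 2 powr ((real_of_int j + 1) * p))"
          unfolding I_def c_def by (subst sum.reindex) (auto intro: inj_int_decode)
        also have "\<dots> \<le> 2 * 2 powr p * (4 / 2 ^ k * ?y) powr p"
          using p by (intro sum_dyadic_powr_le) (auto simp: I_def S_def L_def field_simps)
        also have "\<dots> = 2 * 8 powr p * (2 powr (- p)) ^ k * ?y powr p"
        proof -
          have "(4 / 2 ^ k * ?y) powr p = 4 powr p / (2 ^ k) powr p * ?y powr p"
            by (simp add: powr_mult powr_divide)
          moreover have "(2 ^ k) powr p = 1 / (2 powr (- p)) ^ k"
            by (simp add: powr_minus powr_power powr_realpow[symmetric] powr_powr field_simps)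
          moreover have "8 powr p = 2 powr p * 4 powr p"
            by (simp add: powr_mult[symmetric])
          ultimately show ?thesis by simp
        qed
        finally show "(\<Sum>n<N. ennreal (c n) * indicator (S n k) x) \<le> ennreal (2 * 8 powr p * (2 powr (- p)) ^ k * ?y powr p)"
          by (simp add: ennreal_leI)
      qed
      have "(\<Sum>k. ennreal (d k) * (\<Sum>n. ennreal (c n) * indicator (S n k) x))
        \<le> (\<Sum>k. ennreal (2 * 8 powr p * (D ^ 4 / \<delta>) * ?y powr p * (1 / 2) ^ k))"
      proof (intro suminf_le summableI)
        fix k
        have "ennreal (d k) * (\<Sum>n. ennreal (c n) * indicator (S n k) x)
          \<le> ennreal (d k) * ennreal (2 * 8 powr p * (2 powr (- p)) ^ k * ?y powr p)"
          by (intro mult_left_mono inner) auto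
        also have "\<dots> = ennreal (2 * 8 powr p * (D ^ 4 / \<delta>) * ?y powr p * (2 powr (- p) / \<delta>) ^ k)"
          using dpos[of k] by (simp add: ennreal_mult[symmetric] d_def power_divide field_simps)
        also have "\<dots> \<le> ennreal (2 * 8 powr p * (D ^ 4 / \<delta>) * ?y powr p * (1 / 2) ^ k)"
          using p\<delta> \<delta>(1) X.D_ge_1 by (intro ennreal_leI mult_left_mono power_mono) auto
        finally show "ennreal (d k) * (\<Sum>n. ennreal (c n) * indicator (S n k) x) \<le>
          ennreal (2 * 8 powr p * (D ^ 4 / \<delta>) * ?y powr p * (1 / 2) ^ k)" .
      qed
      also have "\<dots> = ennreal (2 * 8 powr p * (D ^ 4 / \<delta>) * ?y powr p * 2)"
      proof (rule suminf_ennreal_eq)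
        show "(\<lambda>k. 2 * 8 powr p * (D ^ 4 / \<delta>) * ?y powr p * (1 / 2) ^ k) sums (2 * 8 powr p * (D ^ 4 / \<delta>) * ?y powr p * 2)"
          using geometric_sums[of "1 / 2 :: real"] by (intro sums_mult) simp
      qed (use \<delta>(1) X.D_ge_1 in auto)
      also have "\<dots> = ennreal K * ennreal (?y powr p)"
        using \<delta>(1) X.D_ge_1 by (simp add: K_def ennreal_mult[symmetric])
      finally show "(\<Sum>k. ennreal (d k) * (\<Sum>n. ennreal (c n) * indicator (S n k) x)) \<le> ennreal K * ennreal (?y powr p)" .
    qed
    also have "\<dots> = ennreal K * (\<integral>\<^sup>+ x. ennreal (\<bar>f x\<bar> powr p) \<partial>\<mu>)"
      using f by (intro nn_integral_cmult) simp
    finally show "(\<integral>\<^sup>+ x. enn_powr (maxop \<nu> f x) p \<partial>\<mu>) \<le> ennreal K * (\<integral>\<^sup>+ x. ennreal (\<bar>f x\<bar> powr p) \<partial>\<mu>)" .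
  qed
  then show ?thesis using p unfolding A_infty_def by blast
qed

end

text \<open>Stated for all larger constants so that one common D, the maximum, serves both
  measures.\<close>

lemma globally_doublingE:
  assumes "globally_doubling M"
  obtains D where "D \<ge> 1" "\<And>D' x r. D' \<ge> D \<Longrightarrow> r > 0 \<Longrightarrow> emeasure M (ball x (2 * r)) \<le> ennreal D' * emeasure M (ball x r)"
proof -
  obtain C where C: "\<And>x r. r > 0 \<Longrightarrow> emeasure M (ball x (2 * r)) \<le> ennreal C * emeasure M (ball x r)"
    using assms unfolding globally_doubling_def by blast
  have "emeasure M (ball x (2 * r)) \<le> ennreal D' * emeasure M (ball x r)" if "D' \<ge> max 1 C" "r > 0" for D' x r
    using C[OF that(2), of x] that(1)
    by (elim order_trans) (intro mult_right_mono ennreal_leI, auto)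
  then show ?thesis using that[of "max 1 C"] by simp
qed

theorem mainTheorem5:
  fixes \<mu> \<nu> :: "real measure" and C :: real
  assumes "radon \<mu>" and "radon \<nu>"
    and "globally_doubling \<mu>" and "globally_doubling \<nu>"
    and "emeasure \<mu> UNIV \<noteq> 0" and "emeasure \<nu> UNIV \<noteq> 0"
    and "C \<ge> 1"
    and "\<And>x r. r > 0 \<Longrightarrow>
      (\<integral>\<^sup>+ y\<in>ball x (2 * r). (\<integral>\<^sup>+ t\<in>{0<..<2 * r}.
          ennreal ((alpha \<mu> \<nu> (ball y t))\<^sup>2 / t) \<partial>lborel) \<partial>\<mu>)
        \<le> ennreal C * emeasure \<mu> (ball x r)"
  shows "A_infty \<mu> \<nu>"
proof -
  obtain D1 where D1: "D1 \<ge> 1" "\<And>D x r. D \<ge> D1 \<Longrightarrow> r > 0 \<Longrightarrow> emeasure \<mu> (ball x (2 * r)) \<le> ennreal D * emeasure \<mu> (ball x r)"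
    using globally_doublingE[OF assms(3)] by blast
  obtain D2 where D2: "D2 \<ge> 1" "\<And>D x r. D \<ge> D2 \<Longrightarrow> r > 0 \<Longrightarrow> emeasure \<nu> (ball x (2 * r)) \<le> ennreal D * emeasure \<nu> (ball x r)"
    using globally_doublingE[OF assms(4)] by blast
  interpret carleson_pair \<mu> \<nu> "max D1 D2" C
    by unfold_locales (use assms D1 D2 in \<open>auto simp: radon_def\<close>)
  show ?thesis by (rule A_infty)
qed

end
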